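(* Let $\phi=\frac{1+\sqrt5}{2}$ denote the golden ratio. Given a pair of contractions $T_1,T_2\in B(\mathcal{H})$ on a Hilbert space $\mathcal{H}$, there is a Hilbert space $\mathcal{K}\supseteq\mathcal{H}$ and a pair of commuting normal contractions $N_1,N_2\in B(\mathcal{K})$ such that $$T_i=P_{\mathcal{H}}\left(\frac{2}{\sqrt{\phi}}N_i\right)\Big|_{\mathcal{H}},\qquad i=1,2,$$ where $P_{\mathcal{H}}:\mathcal{K}\to\mathcal{H}$ is the orthogonal projection. In other words, the universal commuting dilation constant $C_2$ satisfies $C_2\le \frac{2}{\sqrt{\phi}}$.
   Context: For a positive integer $d$, the universal commuting dilation constant $C_d$ is the smallest constant $\alpha$ such that for every Hilbert space $\mathcal{H}$ and every $d$-tuple of contractions $A=(A_1,\dots,A_d)\in B(\mathcal{H})^d$ there are a Hilbert space $\mathcal{K}\supseteq\mathcal{H}$ and a $d$-tuple $B=(B_1,\dots,B_d)\in B(\mathcal{K})^d$ of commuting normal operators, each of norm at most $\alpha$, with $A_i=P_{\mathcal{H}}B_i|_{\mathcal{H}}$ for $i=1,\dots,d$, where $P_{\mathcal{H}}:\mathcal{K}\to\mathcal{H}$ is the orthogonal projection. *)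

theory Defs
  imports "HOL-Analysis.Analysis"
begin

section \<open>Complex Hilbert spaces\<close>

text \<open>
  A complex inner product space is set up on top of the real inner product space
  given by the real part of the complex inner product, so that norm, topology and
  completeness are those of the library. The inner product is linear in its first
  argument. Positive definiteness is inherited from \<open>real_inner\<close>.
\<close>

class complex_inner = real_inner +
  fixes scaleC :: "complex \<Rightarrow> 'a \<Rightarrow> 'a"  (infixr \<open>*\<^sub>C\<close> 75)
    and cinner :: "'a \<Rightarrow> 'a \<Rightarrow> complex"
  assumes scaleC_add_right: "a *\<^sub>C (x + y) = a *\<^sub>C x + a *\<^sub>C y"
    and scaleC_add_left: "(a + b) *\<^sub>C x = a *\<^sub>C x + b *\<^sub>C x"
    and scaleC_scaleC: "a *\<^sub>C b *\<^sub>C x = (a * b) *\<^sub>C x"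
    and scaleC_of_real: "complex_of_real r *\<^sub>C x = r *\<^sub>R x"
    and cinner_commute: "cinner x y = cnj (cinner y x)"
    and cinner_add_left: "cinner (x + y) z = cinner x z + cinner y z"
    and cinner_scaleC_left: "cinner (a *\<^sub>C x) y = a * cinner x y"
    and inner_eq_Re_cinner: "inner x y = Re (cinner x y)"

class complex_hilbert_space = complex_inner + complete_space

interpretation complex_vector: vector_space "scaleC :: complex \<Rightarrow> 'a::complex_inner \<Rightarrow> 'a"
proof
  show "1 *\<^sub>C x = x" for x :: 'a
    using scaleC_of_real[of 1 x] by simp
qed (rule scaleC_add_right scaleC_add_left scaleC_scaleC)+

text \<open>
  Hilbert spaces are quantified over as closed complex subspaces of an ambient complex
  Hilbert space. Taking the whole ambient type covers every Hilbert space.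
\<close>

definition hilbert_subspace :: "'a::complex_hilbert_space set \<Rightarrow> bool" where
  "hilbert_subspace H \<longleftrightarrow> complex_vector.subspace H \<and> closed H"


section \<open>Bounded operators on a Hilbert space\<close>

text \<open>
  An operator on \<open>H\<close> is a function on the ambient type of which only the values on \<open>H\<close>
  are relevant.
\<close>

definition clinear_on :: "'a::complex_inner set \<Rightarrow> ('a \<Rightarrow> 'b::complex_inner) \<Rightarrow> bool" where
  "clinear_on H f \<longleftrightarrow>
     (\<forall>x\<in>H. \<forall>y\<in>H. f (x + y) = f x + f y) \<and> (\<forall>a. \<forall>x\<in>H. f (a *\<^sub>C x) = a *\<^sub>C f x)"

definition bounded_op :: "'a::complex_inner set \<Rightarrow> ('a \<Rightarrow> 'a) \<Rightarrow> bool" where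
  "bounded_op H A \<longleftrightarrow>
     A ` H \<subseteq> H \<and> clinear_on H A \<and> (\<exists>M. \<forall>x\<in>H. norm (A x) \<le> M * norm x)"

text \<open>For \<open>H = UNIV\<close> this is the library's \<open>onorm\<close>.\<close>

definition op_norm :: "'a::complex_inner set \<Rightarrow> ('a \<Rightarrow> 'a) \<Rightarrow> real" where
  "op_norm H A = (SUP x\<in>H. norm (A x) / norm x)"

definition contraction_op :: "'a::complex_inner set \<Rightarrow> ('a \<Rightarrow> 'a) \<Rightarrow> bool" where
  "contraction_op H A \<longleftrightarrow> bounded_op H A \<and> op_norm H A \<le> 1"

definition adjoint_op :: "'a::complex_inner set \<Rightarrow> ('a \<Rightarrow> 'a) \<Rightarrow> 'a \<Rightarrow> 'a" where
  "adjoint_op H A y = (THE z. z \<in> H \<and> (\<forall>x\<in>H. cinner (A x) y = cinner x z))"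

definition normal_op :: "'a::complex_inner set \<Rightarrow> ('a \<Rightarrow> 'a) \<Rightarrow> bool" where
  "normal_op H A \<longleftrightarrow>
     bounded_op H A \<and> (\<forall>x\<in>H. A (adjoint_op H A x) = adjoint_op H A (A x))"

definition commute_on :: "'a set \<Rightarrow> ('a \<Rightarrow> 'a) \<Rightarrow> ('a \<Rightarrow> 'a) \<Rightarrow> bool" where
  "commute_on H A B \<longleftrightarrow> (\<forall>x\<in>H. A (B x) = B (A x))"

definition orth_proj :: "'a::complex_inner set \<Rightarrow> 'a \<Rightarrow> 'a" where
  "orth_proj M x = (THE y. y \<in> M \<and> (\<forall>z\<in>M. cinner (x - y) z = 0))"

text \<open>
  The inclusion of \<open>H\<close> in a larger Hilbert space \<open>K\<close> is given by a linear isometry \<open>V\<close>, which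
  identifies \<open>H\<close> with the closed subspace \<open>V ` H\<close> of \<open>K\<close>.
\<close>

definition isometric_embedding ::
    "'a::complex_inner set \<Rightarrow> 'b::complex_inner set \<Rightarrow> ('a \<Rightarrow> 'b) \<Rightarrow> bool" where
  "isometric_embedding H K V \<longleftrightarrow>
     V ` H \<subseteq> K \<and> clinear_on H V \<and> (\<forall>x\<in>H. norm (V x) = norm x)"

text \<open>Under this identification, \<open>compression_of H V A B\<close> says that \<open>A\<close> is the compression
  \<open>P\<^sub>H B|\<^sub>H\<close> of \<open>B\<close> to \<open>H\<close>.\<close>

definition compression_of ::
    "'a::complex_inner set \<Rightarrow> ('a \<Rightarrow> 'b::complex_inner) \<Rightarrow> ('a \<Rightarrow> 'a) \<Rightarrow> ('b \<Rightarrow> 'b) \<Rightarrow> bool" where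
  "compression_of H V A B \<longleftrightarrow> (\<forall>x\<in>H. V (A x) = orth_proj (V ` H) (B (V x)))"


section \<open>The Hilbert space of square-summable families\<close>

text \<open>
  A dilation space cannot be quantified over as a type, so it is taken to be a closed
  subspace of a sufficiently large concrete Hilbert space. Any Hilbert space whose
  cardinality is at most that of the index type embeds isometrically into it.
\<close>

typedef 'i ell2 = "{f :: 'i \<Rightarrow> complex. (\<lambda>i. (cmod (f i))\<^sup>2) summable_on UNIV}"
  morphisms ell2_nth Abs_ell2
  by (rule exI[of _ "\<lambda>_. 0"]) simp

lemma ell2_summable: "(\<lambda>i. (cmod (ell2_nth x i))\<^sup>2) summable_on UNIV"
  using ell2_nth[of x] by simp

lemma ell2_eqI: "(\<And>i. ell2_nth x i = ell2_nth y i) \<Longrightarrow> x = y"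
  by (metis ell2_nth_inject ext)

lemma ell2_add_closed:
  fixes f g :: "'i \<Rightarrow> complex"
  assumes "(\<lambda>i. (cmod (f i))\<^sup>2) summable_on UNIV" "(\<lambda>i. (cmod (g i))\<^sup>2) summable_on UNIV"
  shows "(\<lambda>i. (cmod (f i + g i))\<^sup>2) summable_on UNIV"
proof (rule summable_on_comparison_test)
  show "(\<lambda>i. 2 * (cmod (f i))\<^sup>2 + 2 * (cmod (g i))\<^sup>2) summable_on UNIV"
    by (intro summable_on_add summable_on_cmult_right assms)
  show "(cmod (f i + g i))\<^sup>2 \<le> 2 * (cmod (f i))\<^sup>2 + 2 * (cmod (g i))\<^sup>2" for i
  proof -
    have "(cmod (f i + g i))\<^sup>2 \<le> (cmod (f i) + cmod (g i))\<^sup>2"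
      by (intro power_mono norm_triangle_ineq) auto
    also have "\<dots> \<le> 2 * (cmod (f i))\<^sup>2 + 2 * (cmod (g i))\<^sup>2"
      using sum_squares_bound[of "cmod (f i)" "cmod (g i)"] by (simp add: power2_sum)
    finally show ?thesis .
  qed
qed auto

lemma ell2_scale_closed:
  fixes f :: "'i \<Rightarrow> complex"
  assumes "(\<lambda>i. (cmod (f i))\<^sup>2) summable_on UNIV"
  shows "(\<lambda>i. (cmod (a * f i))\<^sup>2) summable_on UNIV"
  using summable_on_cmult_right[OF assms, of "(cmod a)\<^sup>2"]
  by (simp add: norm_mult power_mult_distrib)

lemma ell2_mult_abs_summable:
  "(\<lambda>i. norm (ell2_nth x i * cnj (ell2_nth y i))) summable_on UNIV"
proof (rule summable_on_comparison_test)
  show "(\<lambda>i. (cmod (ell2_nth x i))\<^sup>2 + (cmod (ell2_nth y i))\<^sup>2) summable_on UNIV"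
    by (intro summable_on_add ell2_summable)
  show "norm (ell2_nth x i * cnj (ell2_nth y i))
          \<le> (cmod (ell2_nth x i))\<^sup>2 + (cmod (ell2_nth y i))\<^sup>2" for i
  proof -
    have "0 \<le> cmod (ell2_nth x i) * cmod (ell2_nth y i)"
      by simp
    then show ?thesis
      using sum_squares_bound[of "cmod (ell2_nth x i)" "cmod (ell2_nth y i)"]
      unfolding norm_mult complex_mod_cnj by linarith
  qed
qed auto

lemmas ell2_mult_summable = abs_summable_summable[OF ell2_mult_abs_summable]

instantiation ell2 :: (type) complex_inner
begin

definition "0 = Abs_ell2 (\<lambda>_. 0)"
definition "x + y = Abs_ell2 (\<lambda>i. ell2_nth x i + ell2_nth y i)"
definition "a *\<^sub>C x = Abs_ell2 (\<lambda>i. a * ell2_nth x i)"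
definition "r *\<^sub>R x = complex_of_real r *\<^sub>C x" for x :: "'a ell2"
definition "- x = (- 1) *\<^sub>C x" for x :: "'a ell2"
definition "x - y = x + - y" for x y :: "'a ell2"
definition "cinner x y = infsum (\<lambda>i. ell2_nth x i * cnj (ell2_nth y i)) UNIV"
definition "inner x y = Re (cinner x y)" for x y :: "'a ell2"
definition "norm x = sqrt (inner x x)" for x :: "'a ell2"
definition "sgn x = inverse (norm x) *\<^sub>R x" for x :: "'a ell2"
definition "dist x y = norm (x - y)" for x y :: "'a ell2"
definition "uniformity = (INF e\<in>{0<..}. principal {(x, y :: 'a ell2). dist x y < e})"
definition "open U \<longleftrightarrow> (\<forall>x\<in>U. \<forall>\<^sub>F (x', y) in uniformity. x' = x \<longrightarrow> y \<in> U)" for U :: "'a ell2 set"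

lemma ell2_nth_zero: "ell2_nth 0 i = 0"
  by (simp add: zero_ell2_def Abs_ell2_inverse)

lemma ell2_nth_add: "ell2_nth (x + y) i = ell2_nth x i + ell2_nth y i"
  by (simp add: plus_ell2_def Abs_ell2_inverse ell2_add_closed ell2_summable)

lemma ell2_nth_scaleC: "ell2_nth (a *\<^sub>C x) i = a * ell2_nth x i"
  by (simp add: scaleC_ell2_def Abs_ell2_inverse ell2_scale_closed ell2_summable)

lemma ell2_nth_scaleR: "ell2_nth (r *\<^sub>R x) i = complex_of_real r * ell2_nth x i"
  by (simp add: scaleR_ell2_def ell2_nth_scaleC)

lemma ell2_nth_uminus: "ell2_nth (- x) i = - ell2_nth x i"
  by (simp add: uminus_ell2_def ell2_nth_scaleC)

lemma ell2_nth_diff: "ell2_nth (x - y) i = ell2_nth x i - ell2_nth y i"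
  by (simp add: minus_ell2_def ell2_nth_uminus ell2_nth_add)

lemmas ell2_nth_simps =
  ell2_nth_zero ell2_nth_add ell2_nth_scaleC ell2_nth_scaleR ell2_nth_uminus ell2_nth_diff

lemma ell2_inner_self: "inner x x = infsum (\<lambda>i. (cmod (ell2_nth x i))\<^sup>2) UNIV" for x :: "'a ell2"
proof -
  have "inner x x = infsum (\<lambda>i. Re (ell2_nth x i * cnj (ell2_nth x i))) UNIV"
    unfolding inner_ell2_def cinner_ell2_def by (rule infsum_Re[symmetric, OF ell2_mult_summable])
  then show ?thesis
    by (simp add: complex_mult_cnj cmod_power2)
qed

instance
proof
  fix x y z :: "'a ell2" and r s :: real and a b :: complex
  show "x + y + z = x + (y + z)" "x + y = y + x" "0 + x = x" "- x + x = 0" "x - y = x + - y"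
    "r *\<^sub>R (x + y) = r *\<^sub>R x + r *\<^sub>R y" "(r + s) *\<^sub>R x = r *\<^sub>R x + s *\<^sub>R x"
    "r *\<^sub>R s *\<^sub>R x = (r * s) *\<^sub>R x" "1 *\<^sub>R x = x"
    "a *\<^sub>C (x + y) = a *\<^sub>C x + a *\<^sub>C y" "(a + b) *\<^sub>C x = a *\<^sub>C x + b *\<^sub>C x"
    "a *\<^sub>C b *\<^sub>C x = (a * b) *\<^sub>C x" "complex_of_real r *\<^sub>C x = r *\<^sub>R x"
    by (rule ell2_eqI, simp add: ell2_nth_simps algebra_simps)+
  show "sgn x = inverse (norm x) *\<^sub>R x" "dist x y = norm (x - y)"
    "norm x = sqrt (inner x x)" "inner x y = Re (cinner x y)"
    by (rule sgn_ell2_def dist_ell2_def norm_ell2_def inner_ell2_def)+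
  show "uniformity = (INF e\<in>{0<..}. principal {(x, y :: 'a ell2). dist x y < e})"
    by (rule uniformity_ell2_def)
  show "open U \<longleftrightarrow> (\<forall>x\<in>U. \<forall>\<^sub>F (x', y) in uniformity. x' = x \<longrightarrow> y \<in> U)" for U :: "'a ell2 set"
    by (rule open_ell2_def)
  show comm: "cinner x y = cnj (cinner y x)" for x y :: "'a ell2"
    unfolding cinner_ell2_def infsum_cnj[symmetric] by (simp add: mult.commute)
  show add: "cinner (x + y) z = cinner x z + cinner y z"
    unfolding cinner_ell2_def
    by (simp add: ell2_nth_simps distrib_right infsum_add[OF ell2_mult_summable ell2_mult_summable])
  show scale: "cinner (a *\<^sub>C x) y = a * cinner x y" for a
    unfolding cinner_ell2_def by (simp add: ell2_nth_simps mult.assoc infsum_cmult_right')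
  show "inner x y = inner y x"
    unfolding inner_ell2_def by (subst comm) simp
  show "inner (x + y) z = inner x z + inner y z"
    unfolding inner_ell2_def by (simp add: add)
  show "inner (r *\<^sub>R x) y = r * inner x y"
    unfolding inner_ell2_def scaleR_ell2_def by (simp add: scale)
  show "0 \<le> inner x x"
    unfolding ell2_inner_self by (rule infsum_nonneg) simp
  show "inner x x = 0 \<longleftrightarrow> x = 0"
  proof
    assume "inner x x = 0"
    then have "(cmod (ell2_nth x i))\<^sup>2 = 0" for i
      unfolding ell2_inner_self
      by (intro nonneg_infsum_le_0D[where A = UNIV]) (auto simp: ell2_summable)
    then show "x = 0"
      by (intro ell2_eqI) (simp add: ell2_nth_simps)
  qed (simp add: ell2_inner_self ell2_nth_simps)
qed

end

lemma ell2_norm_square: "(norm x)\<^sup>2 = infsum (\<lambda>i. (cmod (ell2_nth x i))\<^sup>2) UNIV"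
  by (simp add: power2_norm_eq_inner ell2_inner_self)

lemma ell2_finite_sum_le: "finite F \<Longrightarrow> (\<Sum>i\<in>F. (cmod (ell2_nth x i))\<^sup>2) \<le> (norm x)\<^sup>2"
  unfolding ell2_norm_square by (rule finite_sum_le_infsum) (auto simp: ell2_summable)

lemma ell2_nth_norm_le: "cmod (ell2_nth x i) \<le> norm x"
  using ell2_finite_sum_le[of "{i}" x] by (simp add: abs_le_square_iff[symmetric])

instance ell2 :: (type) complex_hilbert_space
proof
  fix X :: "nat \<Rightarrow> 'a ell2"
  assume X: "Cauchy X"
  have "Cauchy (\<lambda>n. ell2_nth (X n) i)" for i
  proof (rule metric_CauchyI)
    fix e :: real assume "0 < e"
    then obtain M where "\<forall>m\<ge>M. \<forall>n\<ge>M. dist (X m) (X n) < e"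
      using X by (meson metric_CauchyD)
    then show "\<exists>M. \<forall>m\<ge>M. \<forall>n\<ge>M. dist (ell2_nth (X m) i) (ell2_nth (X n) i) < e"
      using ell2_nth_norm_le[of "X _ - X _" i]
      by (metis dist_norm ell2_nth_diff order_le_less_trans)
  qed
  then have "\<forall>i. \<exists>l. (\<lambda>n. ell2_nth (X n) i) \<longlonglongrightarrow> l"
    unfolding Cauchy_convergent_iff convergent_def by blast
  from choice[OF this] obtain L where L: "\<And>i. (\<lambda>n. ell2_nth (X n) i) \<longlonglongrightarrow> L i"
    by blast
  have tail: "\<exists>M. \<forall>m\<ge>M. \<forall>F. finite F \<longrightarrow> (\<Sum>i\<in>F. (cmod (ell2_nth (X m) i - L i))\<^sup>2) \<le> e\<^sup>2"
    if e: "0 < e" for e :: real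
  proof -
    obtain M where M: "\<And>m n. m \<ge> M \<Longrightarrow> n \<ge> M \<Longrightarrow> dist (X m) (X n) < e"
      using metric_CauchyD[OF X e] by blast
    have "(\<Sum>i\<in>F. (cmod (ell2_nth (X m) i - L i))\<^sup>2) \<le> e\<^sup>2" if "m \<ge> M" "finite F" for m F
    proof (rule tendsto_upperbound)
      show "(\<lambda>n. \<Sum>i\<in>F. (cmod (ell2_nth (X m) i - ell2_nth (X n) i))\<^sup>2)
              \<longlonglongrightarrow> (\<Sum>i\<in>F. (cmod (ell2_nth (X m) i - L i))\<^sup>2)"
        by (intro tendsto_intros L)
      have "(\<Sum>i\<in>F. (cmod (ell2_nth (X m) i - ell2_nth (X n) i))\<^sup>2) \<le> e\<^sup>2" if "n \<ge> M" for n
      proof -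
        have "(\<Sum>i\<in>F. (cmod (ell2_nth (X m) i - ell2_nth (X n) i))\<^sup>2) \<le> (norm (X m - X n))\<^sup>2"
          using ell2_finite_sum_le[OF \<open>finite F\<close>, of "X m - X n"] by (simp add: ell2_nth_diff)
        also have "\<dots> \<le> e\<^sup>2"
          using M[OF \<open>m \<ge> M\<close> \<open>n \<ge> M\<close>] by (intro power_mono) (auto simp: dist_norm)
        finally show ?thesis .
      qed
      then show "\<forall>\<^sub>F n in sequentially.
          (\<Sum>i\<in>F. (cmod (ell2_nth (X m) i - ell2_nth (X n) i))\<^sup>2) \<le> e\<^sup>2"
        by (auto simp: eventually_sequentially)
    qed simp
    then show ?thesis by blast
  qed
  have diff_summable: "(\<lambda>i. (cmod (ell2_nth (X m) i - L i))\<^sup>2) summable_on UNIV"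
    if bound: "\<forall>F. finite F \<longrightarrow> (\<Sum>i\<in>F. (cmod (ell2_nth (X m) i - L i))\<^sup>2) \<le> e\<^sup>2" for m and e :: real
  proof (rule nonneg_bdd_above_summable_on)
    show "bdd_above (sum (\<lambda>i. (cmod (ell2_nth (X m) i - L i))\<^sup>2) ` {F. F \<subseteq> UNIV \<and> finite F})"
      by (rule bdd_aboveI[of _ "e\<^sup>2"]) (use bound in blast)
  qed simp
  obtain m where "(\<lambda>i. (cmod (ell2_nth (X m) i - L i))\<^sup>2) summable_on UNIV"
  proof -
    from tail[OF zero_less_one] obtain M where
      "\<forall>m\<ge>M. \<forall>F. finite F \<longrightarrow> (\<Sum>i\<in>F. (cmod (ell2_nth (X m) i - L i))\<^sup>2) \<le> 1\<^sup>2" ..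
    then show thesis
      using diff_summable[where m = M and e = 1] that by blast
  qed
  from ell2_add_closed[OF this ell2_scale_closed[OF ell2_summable[of "X m"], of "-1"]]
  have "(\<lambda>i. (cmod (L i))\<^sup>2) summable_on UNIV"
    by simp
  then have nth: "ell2_nth (Abs_ell2 L) i = L i" for i
    by (simp add: Abs_ell2_inverse)
  have "X \<longlonglongrightarrow> Abs_ell2 L"
  proof (rule metric_LIMSEQ_I)
    fix r :: real assume "0 < r"
    then obtain M where M: "\<And>m F. m \<ge> M \<Longrightarrow> finite F \<Longrightarrow>
        (\<Sum>i\<in>F. (cmod (ell2_nth (X m) i - L i))\<^sup>2) \<le> (r / 2)\<^sup>2"
      using tail[of "r / 2"] by auto
    have "dist (X m) (Abs_ell2 L) < r" if "m \<ge> M" for m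
    proof -
      have "(norm (X m - Abs_ell2 L))\<^sup>2 \<le> (r / 2)\<^sup>2"
        unfolding ell2_norm_square
        by (rule infsum_le_finite_sums[OF ell2_summable])
          (use M[OF that] in \<open>simp add: ell2_nth_diff nth\<close>)
      then have "norm (X m - Abs_ell2 L) \<le> r / 2"
        by (rule power2_le_imp_le) (use \<open>0 < r\<close> in simp)
      then show ?thesis
        using \<open>0 < r\<close> by (simp add: dist_norm)
    qed
    then show "\<exists>M. \<forall>m\<ge>M. dist (X m) (Abs_ell2 L) < r" by blast
  qed
  then show "convergent X"
    by (rule convergentI)
qed


section \<open>Commuting normal dilations\<close>

text \<open>
  The ambient space of the dilation space \<open>K\<close> is large enough for this to be no restriction:
  cutting an arbitrary commuting normal dilation down to the smallest subspace containing \<open>H\<close>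
  and reducing all \<open>B i\<close> yields a space of cardinality at most that of \<open>nat \<Rightarrow> 'h\<close>.
\<close>

definition has_commuting_normal_dilation ::
    "'h::complex_hilbert_space set \<Rightarrow> nat \<Rightarrow> (nat \<Rightarrow> 'h \<Rightarrow> 'h) \<Rightarrow> real \<Rightarrow> bool" where
  "has_commuting_normal_dilation H d A \<alpha> \<longleftrightarrow>
     (\<exists>(K :: (nat \<Rightarrow> 'h) ell2 set) V B.
        hilbert_subspace K \<and> isometric_embedding H K V \<and>
        (\<forall>i<d. normal_op K (B i) \<and> op_norm K (B i) \<le> \<alpha>) \<and>
        (\<forall>i<d. \<forall>j<d. commute_on K (B i) (B j)) \<and>
        (\<forall>i<d. compression_of H V (A i) (B i)))"

text \<open>
  The type argument is the universe from which the Hilbert spaces \<open>H\<close> are drawn; every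
  Hilbert space is available in some universe. The smallest admissible constant is rendered
  as an infimum, which equals the minimum whenever a minimum exists. The constant is intended
  for \<open>d > 0\<close>; the infimum is then taken over a set of nonnegative reals.
\<close>

definition universal_dilation_constant :: "'h::complex_hilbert_space itself \<Rightarrow> nat \<Rightarrow> real" where
  "universal_dilation_constant _ d =
     Inf {\<alpha>. \<forall>(H :: 'h set) A. hilbert_subspace H \<and> (\<forall>i<d. contraction_op H (A i)) \<longrightarrow>
                has_commuting_normal_dilation H d A \<alpha>}"

definition golden_ratio :: real where
  "golden_ratio = (1 + sqrt 5) / 2"

end

theory Submission
  imports Defs
begin

text \<open>
  The two contractions may be assumed to be unitaries \<open>U\<^sub>1\<close>, \<open>U\<^sub>2\<close>: Halmos's dilation on
  \<open>H \<times> H\<close> (\<open>halmos_unitary_dilation\<close>) replaces them, and a compression of a compression is a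
  compression.

  For unitaries, consider an induced subgraph \<open>G\<close> of the square lattice \<open>\<int> \<times> \<int>\<close> that is a tree. Let
  \<open>g\<^sub>k\<close> be the word in \<open>U\<^sub>1\<close>, \<open>U\<^sub>2\<close> and their inverses that is read along the path of the tree from
  the origin to \<open>k\<close>, let \<open>c\<^sub>k \<ge> 0\<close> with \<open>\<Sum> c\<^sub>k\<^sup>2 = 1\<close>, and let \<open>V x = (c\<^sub>k g\<^sub>k x)\<^sub>k\<close>, a vector in the sum of
  copies of the space indexed by \<open>\<int> \<times> \<int>\<close>. The two lattice shifts are commuting unitaries on that sum.
  The compression of a shift by \<open>V\<close> only sees pairs of adjacent vertices of \<open>G\<close>; these are edges of the
  tree, so the two words differ by one letter, and the compression of the \<open>i\<close>-th shift is \<open>U\<^sub>i\<close> times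
  the sum of \<open>c\<^sub>k c\<^sub>l\<close> over the edges in direction \<open>i\<close>. If both directions contribute equally, this
  factor is a quarter of the value of the adjacency form at \<open>c\<close>, and one wants trees with a large
  adjacency norm.

  The tree used here is the comb: the horizontal axis as spine, with an infinite vertical line, a
  tooth, through each point of the spine with even abscissa. Its positive generalized eigenvector
  for \<open>\<lambda> = 2 \<surd>\<phi>\<close> takes a value \<open>e\<close> at the even and \<open>o\<close> at the odd points of the spine and
  \<open>e \<mu>\<^sup>y\<close> at distance \<open>y\<close> from the spine, where \<open>\<lambda> = \<mu> + 1/\<mu>\<close>, \<open>\<lambda> o = 2 e\<close> and
  \<open>\<lambda> e = 2 o + 2 \<mu> e\<close>. It is not square summable, but it has period 2 along the spine. The spine can
  therefore be folded to its two classes of points, if the operator that acts along it is kept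
  instead of being expanded in powers: it becomes \<open>U\<close> combined with the exchange of the two classes,
  while the other operator becomes the shift along the teeth. This turns the eigenvector into a unit vector, and
  the constant is attained exactly, without a limit.

  On one comb the two directions contribute differently, namely \<open>2 / (\<surd>5 \<surd>\<phi>)\<close> along the spine
  and \<open>\<surd>\<phi> / \<surd>5\<close> along the teeth. Taking two combs with exchanged roles, each with half of the
  mass, gives the mean \<open>\<surd>\<phi> / 2\<close> to both (\<open>comb_edges\<close>, \<open>comb_dilation\<close>), the inverse of the
  constant of the theorem.

  The dilation space consists of countably many copies of the space on which the unitaries act. An orthonormal
  basis places it inside the concrete space of square-summable families (\<open>hilbert_sum_exists\<close>).
\<close>

section \<open>Complex inner products\<close>

lemma cinner_add_right: "cinner x (y + z) = cinner x y + cinner x z"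
  by (metis cinner_add_left cinner_commute complex_cnj_add)

lemma cinner_scaleC_right: "cinner x (a *\<^sub>C y) = cnj a * cinner x y"
  by (metis cinner_commute cinner_scaleC_left complex_cnj_mult)

lemma cinner_scaleR_left: "cinner (r *\<^sub>R x) y = of_real r * cinner x y"
  by (metis cinner_scaleC_left scaleC_of_real)

lemma cinner_scaleR_right: "cinner x (r *\<^sub>R y) = of_real r * cinner x y"
  by (metis cinner_scaleC_right scaleC_of_real complex_cnj_complex_of_real)

lemma cinner_zero_left [simp]: "cinner 0 y = 0"
  using cinner_scaleR_left[of 0 0 y] by simp

lemma cinner_zero_right [simp]: "cinner x 0 = 0"
  using cinner_scaleR_right[of x 0 0] by simp

lemma cinner_diff_left: "cinner (x - y) z = cinner x z - cinner y z"
  using cinner_add_left[of "x - y" y z] by (simp add: algebra_simps)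

lemma cinner_diff_right: "cinner x (y - z) = cinner x y - cinner x z"
  using cinner_add_right[of x "y - z" z] by (simp add: algebra_simps)

lemma cinner_sum_left: "cinner (sum f F) y = (\<Sum>i\<in>F. cinner (f i) y)"
  by (induction F rule: infinite_finite_induct) (auto simp: cinner_add_left)

lemma cinner_eq_inner: "cinner x y = Complex (inner x y) (inner x (\<i> *\<^sub>C y))"
  by (simp add: inner_eq_Re_cinner cinner_scaleC_right complex_eq_iff)

lemma cinner_self: "cinner x x = complex_of_real ((norm x)\<^sup>2)"
proof -
  have "Im (cinner x x) = 0"
    by (metis cinner_commute Im_complex_of_real complex_cnj_cancel_iff complex_is_Real_iff
        Reals_cnj_iff)
  then show ?thesis
    by (simp add: complex_eq_iff power2_norm_eq_inner inner_eq_Re_cinner)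
qed

lemma norm_scaleC: "norm (a *\<^sub>C x) = cmod a * norm x"
proof -
  have "complex_of_real ((norm (a *\<^sub>C x))\<^sup>2) = cnj a * (a * cinner x x)"
    by (simp only: cinner_self[symmetric] cinner_scaleC_left cinner_scaleC_right)
  also have "\<dots> = (a * cnj a) * cinner x x"
    by (simp only: mult_ac)
  also have "\<dots> = complex_of_real ((cmod a * norm x)\<^sup>2)"
    unfolding complex_norm_square[of a, symmetric] cinner_self[of x]
    by (simp add: power_mult_distrib)
  finally have "(norm (a *\<^sub>C x))\<^sup>2 = (cmod a * norm x)\<^sup>2"
    by (simp only: of_real_eq_iff)
  then show ?thesis
    by (simp add: power2_eq_iff_nonneg)
qed

lemma scaleC_diff_right: "a *\<^sub>C (x - y) = a *\<^sub>C x - a *\<^sub>C (y :: 'a :: complex_inner)"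
  using scaleC_add_right[of a "x - y" y] by (simp add: algebra_simps)

lemma bounded_linear_scaleC: "bounded_linear (\<lambda>x :: 'a :: complex_inner. a *\<^sub>C x)"
proof (rule bounded_linear_intro[where K = "cmod a"])
  show "a *\<^sub>C (r *\<^sub>R x) = r *\<^sub>R (a *\<^sub>C x)" for r and x :: 'a
    by (metis scaleC_of_real scaleC_scaleC mult.commute)
qed (auto simp: scaleC_add_right norm_scaleC)

instance complex_hilbert_space \<subseteq> banach ..

section \<open>Projections and adjoints\<close>

lemma parallelogram_midpoint:
  fixes x y z :: "'a :: real_inner"
  shows "(norm (y - z))\<^sup>2 = 2 * (norm (x - y))\<^sup>2 + 2 * (norm (x - z))\<^sup>2
           - 4 * (norm (x - (1/2) *\<^sub>R (y + z)))\<^sup>2"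
  unfolding power2_norm_eq_inner
  by (simp add: inner_commute algebra_simps inner_add inner_diff)

text \<open>A minimizing sequence for the distance from \<open>x\<close> to \<open>M\<close> is a Cauchy sequence because of the
  parallelogram law.\<close>

lemma orthogonal_projection_exists:
  fixes x :: "'a :: {real_inner, complete_space}"
  assumes M: "subspace M" "closed M"
  obtains y where "y \<in> M" "\<And>z. z \<in> M \<Longrightarrow> inner (x - y) z = 0"
proof -
  define D where "D = (\<lambda>y. (norm (x - y))\<^sup>2) ` M"
  define d where "d = Inf D"
  have D: "D \<noteq> {}" "bdd_below D"
    unfolding D_def using subspace_0[OF M(1)] by (auto intro!: bdd_belowI[of _ 0])
  have d_le: "d \<le> (norm (x - y))\<^sup>2" if "y \<in> M" for y
    unfolding d_def using D that by (intro cInf_lower) (auto simp: D_def)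
  have "\<exists>y\<in>M. (norm (x - y))\<^sup>2 < d + 1 / Suc n" for n
  proof -
    have "Inf D < d + 1 / Suc n" unfolding d_def by simp
    then show ?thesis
      using cInf_less_iff[OF D] by (auto simp: D_def)
  qed
  then obtain Y where Y: "\<And>n. Y n \<in> M" "\<And>n. (norm (x - Y n))\<^sup>2 < d + 1 / Suc n"
    by metis
  have close: "(norm (Y m - Y n))\<^sup>2 \<le> 2 / Suc m + 2 / Suc n" for m n
  proof -
    have "(1/2) *\<^sub>R (Y m + Y n) \<in> M"
      using Y(1) M(1) by (simp add: subspace_add subspace_scale)
    from d_le[OF this] show ?thesis
      using parallelogram_midpoint[of "Y m" "Y n" x] Y(2)[of m] Y(2)[of n] by simp
  qed
  have "Cauchy Y"
  proof (rule metric_CauchyI)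
    fix e :: real assume e: "0 < e"
    obtain N :: nat where N: "4 / e\<^sup>2 < N" using reals_Archimedean2 by blast
    have small: "2 / Suc m < e\<^sup>2 / 2" if "m \<ge> N" for m
    proof -
      have "4 / e\<^sup>2 < Suc m" using N that by linarith
      then show ?thesis using e by (simp add: field_simps)
    qed
    have "dist (Y m) (Y n) < e" if "m \<ge> N" "n \<ge> N" for m n
    proof -
      have "(norm (Y m - Y n))\<^sup>2 < e\<^sup>2"
        using close[of m n] small[OF that(1)] small[OF that(2)] by linarith
      then show ?thesis using e by (simp add: dist_norm power2_less_imp_less)
    qed
    then show "\<exists>N. \<forall>m\<ge>N. \<forall>n\<ge>N. dist (Y m) (Y n) < e" by blast
  qed
  then obtain y where y: "Y \<longlonglongrightarrow> y"
    using Cauchy_convergent_iff convergent_def by blast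
  have yM: "y \<in> M"
    using closed_sequentially[OF M(2)] Y(1) y by blast
  have "(\<lambda>n. (norm (x - Y n))\<^sup>2) \<longlonglongrightarrow> (norm (x - y))\<^sup>2"
    by (intro tendsto_intros y)
  moreover have "(\<lambda>n. d + 1 / Suc n) \<longlonglongrightarrow> d + 0"
    by (intro tendsto_intros LIMSEQ_Suc[OF lim_1_over_n])
  ultimately have le: "(norm (x - y))\<^sup>2 \<le> d"
    using Y(2) by (intro LIMSEQ_le[of "\<lambda>n. (norm (x - Y n))\<^sup>2" _ "\<lambda>n. d + 1 / Suc n"])
      (auto intro: less_imp_le)
  have "inner (x - y) z = 0" if z: "z \<in> M" for z
  proof (cases "z = 0")
    case False
    \<comment> \<open>This \<open>t\<close> minimizes the distance from \<open>x\<close> to the line \<open>y + t z\<close>.\<close>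
    define t where "t = inner (x - y) z / (norm z)\<^sup>2"
    have nz: "(norm z)\<^sup>2 > 0" using False by simp
    have "y + t *\<^sub>R z \<in> M"
      using yM z M(1) by (simp add: subspace_add subspace_scale)
    from d_le[OF this] le
    have "(norm (x - y))\<^sup>2 \<le> (norm (x - y - t *\<^sub>R z))\<^sup>2"
      unfolding diff_diff_add by linarith
    also have "\<dots> = (norm (x - y))\<^sup>2 - 2 * t * inner (x - y) z + t\<^sup>2 * (norm z)\<^sup>2"
      unfolding power2_norm_eq_inner
      by (simp add: inner_diff inner_commute algebra_simps power2_eq_square)
    also have "\<dots> = (norm (x - y))\<^sup>2 - (inner (x - y) z)\<^sup>2 / (norm z)\<^sup>2"
      using nz by (simp add: t_def power2_eq_square divide_simps)
    finally have "(inner (x - y) z)\<^sup>2 / (norm z)\<^sup>2 \<le> 0" by simp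
    then show ?thesis using nz by (simp add: divide_le_0_iff)
  qed simp
  with yM show ?thesis using that by blast
qed

text \<open>A nonzero functional vanishes on a hyperplane; it is the inner product with a normal vector
  \<open>w\<close> of it, suitably scaled.\<close>

lemma riesz_representation:
  fixes f :: "'a :: {real_inner, complete_space} \<Rightarrow> real"
  assumes f: "bounded_linear f"
  obtains z where "\<And>x. f x = inner x z"
proof (cases "\<forall>x. f x = 0")
  case True
  then show ?thesis using that[of 0] by simp
next
  case False
  then obtain u where u: "f u \<noteq> 0" by blast
  interpret f: bounded_linear f by fact
  define M where "M = {x. f x = 0}"
  have "subspace M" unfolding M_def
    by (auto simp: subspace_def f.add f.scaleR f.zero)
  moreover have "closed M" unfolding M_def
    by (intro closed_Collect_eq continuous_intros f.continuous_on)
  ultimately obtain y where y: "y \<in> M" "\<And>z. z \<in> M \<Longrightarrow> inner (u - y) z = 0"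
    using orthogonal_projection_exists by blast
  define w where "w = u - y"
  have fw: "f w = f u" using y(1) by (simp add: w_def M_def f.diff)
  then have w: "w \<noteq> 0" using u f.zero by metis
  show ?thesis
  proof (rule that[of "(f w / (norm w)\<^sup>2) *\<^sub>R w"])
    fix x
    have "f w *\<^sub>R x - f x *\<^sub>R w \<in> M" by (simp add: M_def f.diff f.scaleR)
    then have "inner w (f w *\<^sub>R x - f x *\<^sub>R w) = 0" using y(2) w_def by blast
    then have "f w * inner x w = f x * (norm w)\<^sup>2"
      by (simp add: inner_diff inner_commute power2_norm_eq_inner)
    then show "f x = inner x ((f w / (norm w)\<^sup>2) *\<^sub>R w)"
      using w by (simp add: field_simps)
  qed
qed

text \<open>The adjoint is taken with respect to the real inner product. For a complex linear operator it
  is also the adjoint for the complex inner product, by \<open>cinner_adjoint_of_inner_adjoint\<close>.\<close>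

lemma adjoint_exists:
  fixes f :: "'a :: {real_inner, complete_space} \<Rightarrow>\<^sub>L 'a"
  obtains g :: "'a \<Rightarrow>\<^sub>L 'a" where "\<And>x y. inner (f x) y = inner x (g y)" "norm g \<le> norm f"
proof -
  have "\<exists>z. \<forall>x. inner (f x) y = inner x z" for y
    using riesz_representation[of "\<lambda>x. inner (f x) y"]
    by (metis bounded_linear_compose[OF bounded_linear_inner_left blinfun.bounded_linear_right])
  then obtain g where g: "\<And>x y. inner (f x) y = inner x (g y)" by metis
  have eqI: "u = v" if "\<And>x. inner x u = inner x v" for u v :: 'a
    using that[of "u - v"] by (metis inner_diff_right inner_eq_zero_iff right_minus_eq)
  have le: "norm (g y) \<le> norm y * norm f" for y
  proof (cases "g y = 0")
    case False
    have "norm (g y) * norm (g y) = inner (f (g y)) y"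
      by (simp add: g power2_norm_eq_inner[symmetric] power2_eq_square)
    also have "\<dots> \<le> norm (f (g y)) * norm y" by (rule norm_cauchy_schwarz)
    also have "\<dots> \<le> norm f * norm (g y) * norm y"
      by (intro mult_right_mono norm_blinfun) auto
    finally show ?thesis using False by (simp add: field_simps)
  qed simp
  have bl: "bounded_linear g"
  proof (rule bounded_linear_intro[OF _ _ le])
    show "g (x + y) = g x + g y" for x y
      by (rule eqI) (simp add: g[symmetric] inner_add)
    show "g (r *\<^sub>R x) = r *\<^sub>R g x" for r x
      by (rule eqI) (simp add: g[symmetric])
  qed
  show ?thesis
  proof (rule that[of "Blinfun g"])
    show "inner (f x) y = inner x (Blinfun g y)" for x y
      by (simp add: g bounded_linear_Blinfun_apply[OF bl])
    show "norm (Blinfun g) \<le> norm f"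
      by (rule norm_blinfun_bound) (auto simp: bounded_linear_Blinfun_apply[OF bl] le mult.commute)
  qed
qed

section \<open>Square roots of defect operators\<close>

text \<open>
  The substitution \<open>S = 1 - B\<close> turns \<open>S\<^sup>2 = 1 - X\<close> into the fixed point equation
  \<open>B = (X + B\<^sup>2) / 2\<close>, which is solved by iteration from \<open>0\<close>. The iterates are polynomials in
  \<open>X\<close> with nonnegative coefficients, and so are their increments. Hence for \<open>\<parallel>X\<parallel> \<le> 1\<close> the increments
  are bounded by those of the same iteration for the number \<open>1\<close>, which is increasing and bounded.
  This reaches the boundary case \<open>\<parallel>X\<parallel> = 1\<close>, in which the iteration is not a contraction.
\<close>

interpretation blinfun_compose: bounded_bilinear
  "(o\<^sub>L) :: ('b::real_normed_vector \<Rightarrow>\<^sub>L 'c::real_normed_vector) \<Rightarrow> ('a::real_normed_vector \<Rightarrow>\<^sub>L 'b) \<Rightarrow> _"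
  by (rule bounded_bilinear_blinfun_compose)

primrec root_iter :: "('a::real_normed_vector \<Rightarrow>\<^sub>L 'a) \<Rightarrow> nat \<Rightarrow> ('a \<Rightarrow>\<^sub>L 'a)" where
  "root_iter X 0 = 0"
| "root_iter X (Suc n) = (1/2) *\<^sub>R (X + (root_iter X n o\<^sub>L root_iter X n))"

primrec root_majorant :: "nat \<Rightarrow> real" where
  "root_majorant 0 = 0"
| "root_majorant (Suc n) = (1 + (root_majorant n)\<^sup>2) / 2"

definition defect_root :: "('a::banach \<Rightarrow>\<^sub>L 'a) \<Rightarrow> ('a \<Rightarrow>\<^sub>L 'a)" where
  "defect_root X = id_blinfun - lim (root_iter X)"

lemma root_majorant_bounds: "0 \<le> root_majorant n \<and> root_majorant n \<le> 1"
proof (induction n)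
  case (Suc n)
  then have "(root_majorant n)\<^sup>2 \<le> 1" by (simp add: power_le_one)
  then show ?case by simp
qed simp

lemma root_majorant_incseq: "incseq root_majorant"
proof (rule incseq_SucI)
  fix n
  have "0 \<le> (1 - root_majorant n)\<^sup>2" by simp
  then show "root_majorant n \<le> root_majorant (Suc n)"
    by (simp add: power2_eq_square algebra_simps)
qed

lemma norm_root_iter_le:
  assumes X: "norm X \<le> 1"
  shows "norm (root_iter X n) \<le> root_majorant n"
proof (induction n)
  case (Suc n)
  have "norm (root_iter X n o\<^sub>L root_iter X n) \<le> norm (root_iter X n) * norm (root_iter X n)"
    by (rule norm_blinfun_compose)
  also have "\<dots> \<le> root_majorant n * root_majorant n"
    using Suc by (intro mult_mono) (auto simp: root_majorant_bounds)
  finally show ?case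
    using X norm_triangle_ineq[of X "root_iter X n o\<^sub>L root_iter X n"]
    by (simp add: power2_eq_square)
qed simp

lemma root_iter_diff_le:
  assumes X: "norm X \<le> 1"
  shows "norm (root_iter X (n + k) - root_iter X n) \<le> root_majorant (n + k) - root_majorant n"
proof (induction n)
  case 0
  then show ?case using norm_root_iter_le[OF X, of k] by simp
next
  case (Suc n)
  let ?P = "root_iter X (n + k)" and ?Q = "root_iter X n"
  let ?p = "root_majorant (n + k)" and ?q = "root_majorant n"
  have le: "?q \<le> ?p" using root_majorant_incseq by (simp add: incseq_def)
  \<comment> \<open>\<open>P\<^sup>2 - Q\<^sup>2 = (P - Q) P + Q (P - Q)\<close> holds without commutativity.\<close>
  have "root_iter X (Suc n + k) - root_iter X (Suc n)
          = (1/2) *\<^sub>R (((?P - ?Q) o\<^sub>L ?P) + (?Q o\<^sub>L (?P - ?Q)))"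
    by (simp add: blinfun_compose.diff_left blinfun_compose.diff_right algebra_simps)
  moreover have "norm ((?P - ?Q) o\<^sub>L ?P) \<le> (?p - ?q) * ?p"
    using norm_blinfun_compose[of "?P - ?Q" ?P] Suc norm_root_iter_le[OF X, of "n + k"] le
    by (smt (verit) mult_mono norm_ge_zero)
  moreover have "norm (?Q o\<^sub>L (?P - ?Q)) \<le> ?q * (?p - ?q)"
    using norm_blinfun_compose[of ?Q "?P - ?Q"] Suc norm_root_iter_le[OF X, of n] le
    by (smt (verit) mult_mono norm_ge_zero root_majorant_bounds)
  ultimately have "norm (root_iter X (Suc n + k) - root_iter X (Suc n))
      \<le> ((?p - ?q) * ?p + ?q * (?p - ?q)) / 2"
    using norm_triangle_ineq[of "(?P - ?Q) o\<^sub>L ?P" "?Q o\<^sub>L (?P - ?Q)"] by simp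
  also have "\<dots> = root_majorant (Suc n + k) - root_majorant (Suc n)"
    by (simp add: power2_eq_square field_simps)
  finally show ?case .
qed

lemma root_iter_tendsto:
  fixes X :: "'a::banach \<Rightarrow>\<^sub>L 'a"
  assumes X: "norm X \<le> 1"
  shows "root_iter X \<longlonglongrightarrow> lim (root_iter X)"
proof -
  have "convergent root_majorant"
    by (rule Bseq_mono_convergent) (auto simp: root_majorant_bounds mono_iff_le_Suc
        intro!: BseqI'[of _ 1] incseqD[OF root_majorant_incseq])
  then have "Cauchy root_majorant" by (rule convergent_Cauchy)
  have "Cauchy (root_iter X)"
  proof (rule CauchyI')
    fix e :: real assume "0 < e"
    then obtain M where M: "\<And>m n. m \<ge> M \<Longrightarrow> n \<ge> M \<Longrightarrow> norm (root_majorant m - root_majorant n) < e"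
      using CauchyD[OF \<open>Cauchy root_majorant\<close>] by blast
    have "norm (root_iter X m - root_iter X n) < e" if "m \<ge> M" "n > m" for m n
      using root_iter_diff_le[OF X, of m "n - m"] M[of n m] that
      by (simp add: norm_minus_commute)
    then show "\<exists>M. \<forall>m\<ge>M. \<forall>n>m. dist (root_iter X m) (root_iter X n) < e"
      by (auto simp: dist_norm)
  qed
  then show ?thesis
    using Cauchy_convergent_iff convergent_LIMSEQ_iff by blast
qed

lemma defect_root_square:
  fixes X :: "'a::banach \<Rightarrow>\<^sub>L 'a"
  assumes X: "norm X \<le> 1"
  shows "defect_root X o\<^sub>L defect_root X = id_blinfun - X"
proof -
  define B where "B = lim (root_iter X)"
  have B: "root_iter X \<longlonglongrightarrow> B" using root_iter_tendsto[OF X] by (simp add: B_def)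
  have "(\<lambda>n. root_iter X (Suc n)) \<longlonglongrightarrow> (1/2) *\<^sub>R (X + (B o\<^sub>L B))"
    unfolding root_iter.simps by (intro tendsto_intros blinfun_compose.tendsto B)
  then have "B = (1/2) *\<^sub>R (X + (B o\<^sub>L B))"
    using LIMSEQ_unique LIMSEQ_Suc[OF B] by blast
  then have "2 *\<^sub>R B = 2 *\<^sub>R ((1/2) *\<^sub>R (X + (B o\<^sub>L B)))" by simp
  then have BB: "(B o\<^sub>L B) = B + B - X"
    by (simp add: algebra_simps scaleR_2)
  have "(id_blinfun - B) o\<^sub>L (id_blinfun - B) = id_blinfun - X"
    by (rule blinfun_eqI)
       (simp add: blinfun.diff_left blinfun.diff_right BB[THEN arg_cong[of _ _ blinfun_apply], 
          THEN fun_cong, simplified] blinfun.add_left)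
  then show ?thesis by (simp add: defect_root_def B_def)
qed

text \<open>Intertwining passes to polynomials and limits. With \<open>A = T\<close> this is the relation between the
  defect operators of \<open>T\<close> and of its adjoint; with \<open>X = Y\<close> and \<open>A\<close> a complex scalar it gives complex
  linearity of the root, which is constructed among the real linear operators.\<close>

lemma defect_root_intertwines:
  fixes X :: "'a::banach \<Rightarrow>\<^sub>L 'a" and Y :: "'b::banach \<Rightarrow>\<^sub>L 'b" and A :: "'a \<Rightarrow>\<^sub>L 'b"
  assumes X: "norm X \<le> 1" and Y: "norm Y \<le> 1" and A: "A o\<^sub>L X = Y o\<^sub>L A"
  shows "A o\<^sub>L defect_root X = defect_root Y o\<^sub>L A"
proof -
  have A': "A (X z) = Y (A z)" for z
    using A by (metis blinfun_apply_blinfun_compose)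
  have iter: "A (root_iter X n z) = root_iter Y n (A z)" for n z
    by (induction n arbitrary: z)
       (simp_all add: blinfun.add_left blinfun.add_right blinfun.scaleR_left blinfun.scaleR_right A')
  have "(\<lambda>n. A o\<^sub>L root_iter X n) \<longlonglongrightarrow> (A o\<^sub>L lim (root_iter X))"
    by (intro blinfun_compose.tendsto tendsto_const root_iter_tendsto X)
  moreover have "(\<lambda>n. root_iter Y n o\<^sub>L A) \<longlonglongrightarrow> (lim (root_iter Y) o\<^sub>L A)"
    by (intro blinfun_compose.tendsto tendsto_const root_iter_tendsto Y)
  moreover have "(\<lambda>n. A o\<^sub>L root_iter X n) = (\<lambda>n. root_iter Y n o\<^sub>L A)"
    by (intro ext blinfun_eqI) (simp add: iter)
  ultimately have "A o\<^sub>L lim (root_iter X) = lim (root_iter Y) o\<^sub>L A"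
    using LIMSEQ_unique by metis
  then have "A (lim (root_iter X) z) = lim (root_iter Y) (A z)" for z
    by (metis blinfun_apply_blinfun_compose)
  then show ?thesis
    by (intro blinfun_eqI) (simp add: defect_root_def blinfun.diff_left blinfun.diff_right)
qed

lemma defect_root_selfadjoint:
  fixes X :: "'a::{real_inner, banach} \<Rightarrow>\<^sub>L 'a"
  assumes X: "norm X \<le> 1" and sa: "\<And>x y. inner (X x) y = inner x (X y)"
  shows "inner (defect_root X x) y = inner x (defect_root X y)"
proof -
  have iter: "inner (root_iter X n x) y = inner x (root_iter X n y)" for n x y
    by (induction n arbitrary: x y)
       (simp_all add: blinfun.add_left blinfun.scaleR_left inner_add_left inner_add_right sa)
  have lim: "(\<lambda>n. root_iter X n z) \<longlonglongrightarrow> lim (root_iter X) z" for z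
    by (intro tendsto_intros root_iter_tendsto X)
  have "(\<lambda>n. inner (root_iter X n x) y) \<longlonglongrightarrow> inner (lim (root_iter X) x) y"
    by (intro tendsto_intros lim)
  moreover have "(\<lambda>n. inner x (root_iter X n y)) \<longlonglongrightarrow> inner x (lim (root_iter X) y)"
    by (intro tendsto_intros lim)
  ultimately have "inner (lim (root_iter X) x) y = inner x (lim (root_iter X) y)"
    using LIMSEQ_unique iter by simp
  then show ?thesis
    by (simp add: defect_root_def blinfun.diff_left inner_diff_left inner_diff_right)
qed

section \<open>Unitary dilation of a contraction\<close>

instantiation prod :: (complex_inner, complex_inner) complex_inner
begin

definition "a *\<^sub>C p = (a *\<^sub>C fst p, a *\<^sub>C snd p)" for p :: "'a \<times> 'b"
definition "cinner p q = cinner (fst p) (fst q) + cinner (snd p) (snd q)" for p q :: "'a \<times> 'b"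

instance
proof
  fix x y z :: "'a \<times> 'b" and a b :: complex and r :: real
  show "cinner x y = cnj (cinner y x)"
    by (metis cinner_commute cinner_prod_def complex_cnj_add)
qed (simp_all add: scaleC_prod_def cinner_prod_def scaleC_add_right scaleC_add_left scaleC_scaleC
    scaleC_of_real scaleR_prod_def cinner_add_left cinner_scaleC_left inner_prod_def
    inner_eq_Re_cinner distrib_left)

end

instance prod :: (complex_hilbert_space, complex_hilbert_space) complex_hilbert_space ..

definition unitary_pair ::
    "('a::complex_inner \<Rightarrow> 'a) \<Rightarrow> ('a \<Rightarrow> 'a) \<Rightarrow> bool" where
  "unitary_pair U U' \<longleftrightarrow> clinear_on UNIV U \<and> clinear_on UNIV U' \<and>
     (\<forall>x y. cinner (U x) y = cinner x (U' y)) \<and> (\<forall>x. U (U' x) = x) \<and> (\<forall>x. U' (U x) = x)"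

lemma cinner_adjoint_of_inner_adjoint:
  fixes f :: "'a::complex_inner \<Rightarrow> 'b::complex_inner"
  assumes f: "\<And>a x. f (a *\<^sub>C x) = a *\<^sub>C f x" and adj: "\<And>x y. inner (f x) y = inner x (g y)"
  shows "cinner (f x) y = cinner x (g y)"
proof -
  have im: "Im (cinner u v) = - inner (\<i> *\<^sub>C u) v" for u v :: "'c::complex_inner"
    by (simp add: inner_eq_Re_cinner cinner_scaleC_left)
  show ?thesis
    by (simp add: complex_eq_iff im f[symmetric] adj) (simp add: inner_eq_Re_cinner[symmetric] adj)
qed

lemma adjoint_is_clinear:
  fixes f :: "'a::complex_inner \<Rightarrow> 'b::complex_inner"
  assumes adj: "\<And>x y. cinner (f x) y = cinner x (g y)"
  shows "clinear_on UNIV g"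
proof -
  have eqI: "u = v" if "\<And>x. cinner x u = cinner x v" for u v :: 'a
  proof -
    have "cinner (u - v) (u - v) = 0" using that by (simp add: cinner_diff_right)
    then show ?thesis by (simp add: cinner_self)
  qed
  show ?thesis unfolding clinear_on_def
    by (auto intro!: eqI simp: adj[symmetric] cinner_add_right cinner_scaleC_right)
qed

text \<open>
  With the defect operators \<open>D = (1 - T\<^sup>* T)\<^sup>1\<^sup>/\<^sup>2\<close> and \<open>E = (1 - T T\<^sup>*)\<^sup>1\<^sup>/\<^sup>2\<close>, the block operator with rows
  \<open>(T, E)\<close> and \<open>(D, -T\<^sup>*)\<close> is unitary; the off-diagonal entries of \<open>U\<^sup>* U\<close> and \<open>U U\<^sup>*\<close> vanish because
  \<open>T D = E T\<close>.
\<close>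

theorem halmos_unitary_dilation:
  fixes T :: "'h::complex_hilbert_space \<Rightarrow> 'h"
  assumes lin: "clinear_on UNIV T" and contr: "\<And>x. norm (T x) \<le> norm x"
  obtains U U' :: "'h \<times> 'h \<Rightarrow> 'h \<times> 'h" where
    "unitary_pair U U'" "\<And>x. fst (U (x, 0)) = T x"
proof -
  have add: "T (x + y) = T x + T y" and sc: "T (a *\<^sub>C x) = a *\<^sub>C T x" for x y a
    using lin by (auto simp: clinear_on_def)
  have scR: "T (r *\<^sub>R x) = r *\<^sub>R T x" for r x
    by (metis sc scaleC_of_real)
  have bl: "bounded_linear T"
    by (rule bounded_linear_intro[where K = 1]) (auto simp: add scR contr)
  define A where "A = Blinfun T"
  have A: "A x = T x" for x by (simp add: A_def bounded_linear_Blinfun_apply[OF bl])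
  have nA: "norm A \<le> 1" by (rule norm_blinfun_bound) (auto simp: A contr)
  obtain A' :: "'h \<Rightarrow>\<^sub>L 'h" where A': "\<And>x y. inner (A x) y = inner x (A' y)" and "norm A' \<le> norm A"
    using adjoint_exists[of A] by metis
  then have nA': "norm A' \<le> 1" using nA by simp
  have cadj: "cinner (A x) y = cinner x (A' y)" for x y
    by (rule cinner_adjoint_of_inner_adjoint) (auto simp: A sc A'[unfolded A])
  have lin': "clinear_on UNIV A'" by (rule adjoint_is_clinear[OF cadj])
  have cadj': "cinner (A' x) y = cinner x (A y)" for x y
    by (metis cadj cinner_commute)
  define D where "D = defect_root (A' o\<^sub>L A)"
  define E where "E = defect_root (A o\<^sub>L A')"
  have n1: "norm (A' o\<^sub>L A) \<le> 1" and n2: "norm (A o\<^sub>L A') \<le> 1"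
    using norm_blinfun_compose[of A' A] norm_blinfun_compose[of A A'] nA nA'
      mult_mono[OF nA nA'] mult_mono[OF nA' nA] by (simp_all add: order_trans)
  have DD: "D (D x) = x - A' (A x)" and EE: "E (E x) = x - A (A' x)" for x
    using defect_root_square[OF n1] defect_root_square[OF n2]
    by (metis D_def E_def blinfun_apply_blinfun_compose blinfun.diff_left id_blinfun.rep_eq)+
  have "A o\<^sub>L (A' o\<^sub>L A) = (A o\<^sub>L A') o\<^sub>L A" by (rule blinfun_eqI) simp
  from defect_root_intertwines[OF n1 n2 this] have AD: "A (D x) = E (A x)" for x
    unfolding D_def E_def by (metis blinfun_apply_blinfun_compose)
  have "A' o\<^sub>L (A o\<^sub>L A') = (A' o\<^sub>L A) o\<^sub>L A'" by (rule blinfun_eqI) simp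
  from defect_root_intertwines[OF n2 n1 this] have A'E: "A' (E x) = D (A' x)" for x
    unfolding D_def E_def by (metis blinfun_apply_blinfun_compose)
  have commute_scale: "defect_root X (a *\<^sub>C x) = a *\<^sub>C defect_root X x"
    if n: "norm X \<le> 1" and X: "\<And>x. X (a *\<^sub>C x) = a *\<^sub>C X x" for X :: "'h \<Rightarrow>\<^sub>L 'h" and a x
  proof -
    define S where "S = Blinfun (\<lambda>x :: 'h. a *\<^sub>C x)"
    have S: "S x = a *\<^sub>C x" for x
      by (simp add: S_def bounded_linear_Blinfun_apply[OF bounded_linear_scaleC])
    have "S o\<^sub>L X = X o\<^sub>L S" by (rule blinfun_eqI) (simp add: S X)
    from defect_root_intertwines[OF n n this] show ?thesis
      by (metis S blinfun_apply_blinfun_compose)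
  qed
  have Dsc: "D (a *\<^sub>C x) = a *\<^sub>C D x" and Esc: "E (a *\<^sub>C x) = a *\<^sub>C E x" for a x
    unfolding D_def E_def using lin'
    by (auto intro!: commute_scale n1 n2 simp: A sc clinear_on_def)
  have Dsa: "cinner (D x) y = cinner x (D y)" and Esa: "cinner (E x) y = cinner x (E y)" for x y
  proof -
    have "inner (D x) y = inner x (D y)" for x y unfolding D_def
      by (rule defect_root_selfadjoint[OF n1]) (metis A' inner_commute blinfun_apply_blinfun_compose)
    then show "cinner (D x) y = cinner x (D y)"
      using cinner_adjoint_of_inner_adjoint[of D D] Dsc by blast
    have "inner (E x) y = inner x (E y)" for x y unfolding E_def
      by (rule defect_root_selfadjoint[OF n2]) (metis A' inner_commute blinfun_apply_blinfun_compose)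
    then show "cinner (E x) y = cinner x (E y)"
      using cinner_adjoint_of_inner_adjoint[of E E] Esc by blast
  qed
  define U where "U = (\<lambda>(x, y). (A x + E y, D x - A' y))"
  define U' where "U' = (\<lambda>(x, y). (A' x + D y, E x - A y))"
  have adj: "cinner (U p) q = cinner p (U' q)" for p q
    by (cases p; cases q) (simp add: U_def U'_def cinner_prod_def cinner_add_left cinner_add_right
        cinner_diff_left cinner_diff_right cadj cadj' Dsa Esa)
  have adj': "cinner (U' p) q = cinner p (U q)" for p q
    by (metis adj cinner_commute)
  have "U (U' p) = p" and "U' (U p) = p" for p
    by (cases p, simp add: U_def U'_def blinfun.add_right blinfun.diff_right AD A'E DD EE)+
  then have "unitary_pair U U'"
    using adjoint_is_clinear[OF adj] adjoint_is_clinear[OF adj'] adj by (simp add: unitary_pair_def)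
  moreover have "fst (U (x, 0)) = T x" for x by (simp add: U_def A)
  ultimately show ?thesis using that by blast
qed

section \<open>Orthonormal bases\<close>

lemma subspace_closure:
  fixes S :: "'a::real_normed_vector set"
  assumes S: "subspace S"
  shows "subspace (closure S)"
  unfolding subspace_def
proof (intro conjI ballI allI)
  show "0 \<in> closure S" using subspace_0[OF S] closure_subset by blast
next
  fix x y assume "x \<in> closure S" "y \<in> closure S"
  then obtain X Y where "\<And>n. X n \<in> S" "X \<longlonglongrightarrow> x" "\<And>n. Y n \<in> S" "Y \<longlonglongrightarrow> y"
    unfolding closure_sequential by blast
  then have "\<forall>n. X n + Y n \<in> S" "(\<lambda>n. X n + Y n) \<longlonglongrightarrow> x + y"
    using subspace_add[OF S] by (auto intro: tendsto_add)
  then show "x + y \<in> closure S"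
    unfolding closure_sequential by (intro exI[of _ "\<lambda>n. X n + Y n"] conjI)
next
  fix r x assume "x \<in> closure S"
  then obtain X where "\<And>n. X n \<in> S" "X \<longlonglongrightarrow> x"
    unfolding closure_sequential by blast
  then have "\<forall>n. r *\<^sub>R X n \<in> S" "(\<lambda>n. r *\<^sub>R X n) \<longlonglongrightarrow> r *\<^sub>R x"
    using subspace_scale[OF S] by (auto intro: tendsto_scaleR)
  then show "r *\<^sub>R x \<in> closure S"
    unfolding closure_sequential by (intro exI[of _ "\<lambda>n. r *\<^sub>R X n"] conjI)
qed

lemma complex_subspace_imp_subspace:
  "complex_vector.subspace S \<Longrightarrow> subspace S"
  unfolding complex_vector.subspace_def subspace_def by (metis scaleC_of_real)

definition orthonormal :: "'a::complex_inner set \<Rightarrow> bool" where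
  "orthonormal B \<longleftrightarrow> (\<forall>b\<in>B. \<forall>c\<in>B. cinner b c = (if b = c then 1 else 0))"

lemma orthonormal_norm:
  assumes "orthonormal B" "b \<in> B"
  shows "norm b = 1"
proof -
  have "complex_of_real ((norm b)\<^sup>2) = complex_of_real 1"
    using assms unfolding cinner_self[symmetric] by (simp add: orthonormal_def)
  then have "(norm b)\<^sup>2 = 1"
    by (simp only: of_real_eq_iff)
  then show ?thesis
    using power2_eq_iff_nonneg[of "norm b" 1] by simp
qed

text \<open>This is Bessel's inequality for \<open>a b = cinner x b\<close>, and in general it says that no other
  combination over \<open>F\<close> is closer to \<open>x\<close>.\<close>

lemma norm_diff_orthonormal_combination:
  fixes x :: "'a::complex_inner"
  assumes B: "orthonormal B" and F: "finite F" "F \<subseteq> B"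
  shows "(norm (x - (\<Sum>b\<in>F. a b *\<^sub>C b)))\<^sup>2
           = (norm x)\<^sup>2 - (\<Sum>b\<in>F. (cmod (cinner x b))\<^sup>2) + (\<Sum>b\<in>F. (cmod (a b - cinner x b))\<^sup>2)"
proof -
  define s where "s = (\<Sum>b\<in>F. a b *\<^sub>C b)"
  have sum_right: "cinner y s = (\<Sum>b\<in>F. cnj (a b) * cinner y b)" for y
  proof -
    have "cinner s y = (\<Sum>b\<in>F. a b * cinner b y)"
      by (simp add: s_def cinner_sum_left cinner_scaleC_left)
    then have "cnj (cinner s y) = (\<Sum>b\<in>F. cnj (a b) * cnj (cinner b y))"
      by simp
    then show ?thesis by (simp add: cinner_commute[symmetric])
  qed
  have sb: "cinner s b = a b" if "b \<in> F" for b
  proof -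
    have "cinner s b = (\<Sum>c\<in>F. if c = b then a c else 0)"
      unfolding s_def cinner_sum_left cinner_scaleC_left
      using B F that by (intro sum.cong) (auto simp: orthonormal_def subset_iff)
    then show ?thesis using F that by simp
  qed
  have ss: "cinner s s = (\<Sum>b\<in>F. cnj (a b) * a b)"
    unfolding sum_right by (intro sum.cong) (auto simp: sb)
  have "(norm (x - s))\<^sup>2 = (norm x)\<^sup>2 - 2 * inner x s + inner s s"
    unfolding power2_norm_eq_inner by (simp add: inner_diff inner_commute)
  also have "\<dots> = (norm x)\<^sup>2 + (\<Sum>b\<in>F. Re (cnj (a b) * a b) - 2 * Re (cnj (a b) * cinner x b))"
    by (simp add: inner_eq_Re_cinner ss sum_right[of x] sum_subtractf sum_distrib_left)
  also have "(\<Sum>b\<in>F. Re (cnj (a b) * a b) - 2 * Re (cnj (a b) * cinner x b))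
      = (\<Sum>b\<in>F. (cmod (a b - cinner x b))\<^sup>2 - (cmod (cinner x b))\<^sup>2)"
    by (intro sum.cong refl, unfold cmod_power2) (simp add: power2_eq_square algebra_simps)
  finally show ?thesis by (simp add: s_def sum_subtractf)
qed

text \<open>Otherwise the normalized component \<open>e\<close> of some vector orthogonal to the closed span could be
  added to \<open>B\<close>.\<close>

lemma maximal_orthonormal_dense:
  fixes B :: "'a::complex_hilbert_space set"
  assumes B: "orthonormal B" and max: "\<And>C. orthonormal C \<Longrightarrow> B \<subseteq> C \<Longrightarrow> C = B"
  shows "closure (complex_vector.span B) = UNIV"
proof (rule ccontr)
  define M where "M = closure (complex_vector.span B)"
  have "subspace M"
    unfolding M_def
    by (intro subspace_closure complex_subspace_imp_subspace complex_vector.subspace_span)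
  have "closed M" unfolding M_def by simp
  assume "closure (complex_vector.span B) \<noteq> UNIV"
  then obtain x where "x \<notin> M" unfolding M_def by blast
  obtain y where y: "y \<in> M" "\<And>z. z \<in> M \<Longrightarrow> inner (x - y) z = 0"
    using orthogonal_projection_exists[OF \<open>subspace M\<close> \<open>closed M\<close>, of x] by blast
  define e where "e = (1 / norm (x - y)) *\<^sub>R (x - y)"
  have "x - y \<noteq> 0" using y \<open>x \<notin> M\<close> by auto
  then have "norm e = 1" by (simp add: e_def)
  have eM: "inner e z = 0" if "z \<in> M" for z using y that by (simp add: e_def)
  have "cinner e b = 0" if "b \<in> B" for b
  proof -
    have "b \<in> complex_vector.span B" using that by (rule complex_vector.span_base)
    then have "b \<in> M" "\<i> *\<^sub>C b \<in> M"
      using closure_subset[of "complex_vector.span B"] complex_vector.span_scale[of b B \<i>]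
      unfolding M_def by blast+
    then show ?thesis using eM by (simp add: cinner_eq_inner complex_eq_iff)
  qed
  moreover have "cinner e e = 1" using \<open>norm e = 1\<close> by (simp add: cinner_self)
  ultimately have "orthonormal (insert e B)"
    using B unfolding orthonormal_def by (metis cinner_commute complex_cnj_zero insert_iff)
  then have "e \<in> B" using max by blast
  then have "e \<in> M"
    using complex_vector.span_base[of e B] closure_subset[of "complex_vector.span B"]
    unfolding M_def by blast
  then show False using eM[of e] \<open>norm e = 1\<close> by simp
qed

lemma orthonormal_basis_exists:
  obtains B :: "'a::complex_hilbert_space set" where "orthonormal B"
    "\<And>x. ((\<lambda>b. (cmod (cinner x b))\<^sup>2) has_sum (norm x)\<^sup>2) B"
proof -
  have "\<exists>B\<in>Collect orthonormal. \<forall>C\<in>Collect orthonormal. B \<subseteq> C \<longrightarrow> C = (B :: 'a set)"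
  proof (rule subset_Zorn')
    fix C assume C: "subset.chain (Collect orthonormal) (C :: 'a set set)"
    have "cinner b c = (if b = c then 1 else 0)" if b: "b \<in> X" "X \<in> C" and c: "c \<in> Y" "Y \<in> C"
      for b c X Y
    proof -
      have "orthonormal X" "orthonormal Y" "X \<subseteq> Y \<or> Y \<subseteq> X"
        using C b c unfolding subset.chain_def by auto
      then show ?thesis using b c unfolding orthonormal_def by blast
    qed
    then show "\<Union>C \<in> Collect orthonormal" unfolding orthonormal_def by blast
  qed
  then obtain B :: "'a set" where B: "orthonormal B"
    and max: "\<And>C. orthonormal C \<Longrightarrow> B \<subseteq> C \<Longrightarrow> C = B"
    by blast
  have "((\<lambda>b. (cmod (cinner x b))\<^sup>2) has_sum (norm x)\<^sup>2) B" for x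
  proof -
    let ?f = "\<lambda>b. (cmod (cinner x b))\<^sup>2"
    let ?S = "sum ?f ` {F. finite F \<and> F \<subseteq> B}"
    have le: "sum ?f F \<le> (norm x)\<^sup>2" if "finite F" "F \<subseteq> B" for F
      using norm_diff_orthonormal_combination[OF B that, of x "cinner x"]
        zero_le_power2[of "norm (x - (\<Sum>b\<in>F. cinner x b *\<^sub>C b))"] by simp
    have bdd: "bdd_above ?S" using le by (auto intro!: bdd_aboveI[of _ "(norm x)\<^sup>2"])
    \<comment> \<open>Vectors of the span come close to \<open>x\<close>, and the partial Fourier sums come closer.\<close>
    have "(norm x)\<^sup>2 \<le> Sup ?S + e" if "e > 0" for e
    proof -
      have "x \<in> closure (complex_vector.span B)"
        using maximal_orthonormal_dense[OF B max] by blast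
      then obtain s where s: "s \<in> complex_vector.span B" "dist s x < sqrt e"
        using \<open>e > 0\<close> unfolding closure_approachable by (meson real_sqrt_gt_zero)
      then obtain F a where F: "finite F" "F \<subseteq> B" "s = (\<Sum>b\<in>F. a b *\<^sub>C b)"
        unfolding complex_vector.span_explicit by blast
      have "0 \<le> (\<Sum>b\<in>F. (cmod (a b - cinner x b))\<^sup>2)" by (intro sum_nonneg) auto
      then have "(norm x)\<^sup>2 - sum ?f F \<le> (norm (x - s))\<^sup>2"
        unfolding F(3) norm_diff_orthonormal_combination[OF B F(1,2)] by simp
      also have "\<dots> \<le> (sqrt e)\<^sup>2"
        using s(2) by (intro power_mono) (auto simp: dist_norm norm_minus_commute)
      finally have "(norm x)\<^sup>2 \<le> sum ?f F + e" using \<open>e > 0\<close> by simp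
      moreover have "sum ?f F \<le> Sup ?S" using F bdd by (intro cSup_upper) auto
      ultimately show ?thesis by simp
    qed
    then have "(norm x)\<^sup>2 \<le> Sup ?S" by (rule field_le_epsilon)
    moreover have "Sup ?S \<le> (norm x)\<^sup>2" using le by (intro cSup_least) auto
    moreover have "(?f has_sum Sup ?S) B"
      using bdd by (intro nonneg_bdd_above_has_sum) (auto simp: conj_commute)
    ultimately show ?thesis by (simp add: order_antisym)
  qed
  with B show ?thesis using that by blast
qed

section \<open>Hilbert sums of copies of one space\<close>

definition square_summable :: "('j \<Rightarrow> 'l::complex_hilbert_space) \<Rightarrow> bool" where
  "square_summable v \<longleftrightarrow> (\<lambda>j. (norm (v j))\<^sup>2) summable_on UNIV"

text \<open>
  \<open>family\<close> is a unitary operator from the space of square-summable families onto \<open>K\<close>. The locale makes it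
  possible to compute with vectors of \<open>K\<close> as with families whose entries lie in \<open>'l\<close>, although \<open>K\<close>
  is a subspace of a space of scalar families.
\<close>

locale hilbert_sum =
  fixes K :: "'k::complex_hilbert_space set" and family :: "('j \<Rightarrow> 'l::complex_hilbert_space) \<Rightarrow> 'k"
  assumes subspace_K: "hilbert_subspace K"
    and family_bij: "bij_betw family {v. square_summable v} K"
    and family_add: "square_summable v \<Longrightarrow> square_summable w \<Longrightarrow>
      family (\<lambda>j. v j + w j) = family v + family w"
    and family_scaleC: "square_summable v \<Longrightarrow> family (\<lambda>j. a *\<^sub>C v j) = a *\<^sub>C family v"
    and family_norm: "square_summable v \<Longrightarrow>
      ((\<lambda>j. (norm (v j))\<^sup>2) has_sum (norm (family v))\<^sup>2) UNIV"

lemma square_summable_add: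
  assumes "square_summable v" "square_summable w"
  shows "square_summable (\<lambda>j. v j + w j)"
  unfolding square_summable_def
proof (rule summable_on_comparison_test)
  show "(\<lambda>j. 2 * (norm (v j))\<^sup>2 + 2 * (norm (w j))\<^sup>2) summable_on UNIV"
    using assms unfolding square_summable_def
    by (intro summable_on_add summable_on_cmult_right)
  show "(norm (v j + w j))\<^sup>2 \<le> 2 * (norm (v j))\<^sup>2 + 2 * (norm (w j))\<^sup>2" for j
  proof -
    have "(norm (v j + w j))\<^sup>2 \<le> (norm (v j) + norm (w j))\<^sup>2"
      by (intro power_mono norm_triangle_ineq) auto
    also have "\<dots> \<le> 2 * (norm (v j))\<^sup>2 + 2 * (norm (w j))\<^sup>2"
      using sum_squares_bound[of "norm (v j)" "norm (w j)"] by (simp add: power2_sum)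
    finally show ?thesis .
  qed
qed auto

lemma square_summable_scaleC:
  assumes "square_summable v"
  shows "square_summable (\<lambda>j. a *\<^sub>C v j)"
  using assms unfolding square_summable_def
  by (auto simp: norm_scaleC power_mult_distrib intro: summable_on_cmult_right)

text \<open>
  A family of vectors is encoded by its coordinates with respect to an orthonormal basis of \<open>'l\<close>. Only
  the basis vectors are used as indices, and these are nonzero; this is why \<open>\<iota>\<close> may fail to be injective
  on pairs with second entry \<open>0\<close>. The range is closed: in a convergent sequence of encoded
  families each entry is a Cauchy sequence, and the coordinates of the entrywise limits are those of the
  limit.
\<close>

lemma hilbert_sum_exists:
  fixes \<iota> :: "'j \<times> 'l::complex_hilbert_space \<Rightarrow> 'i"
  assumes inj: "inj_on \<iota> {p. snd p \<noteq> 0}"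
  obtains K :: "'i ell2 set" and family :: "('j \<Rightarrow> 'l) \<Rightarrow> 'i ell2"
  where "hilbert_sum K family"
proof -
  obtain B :: "'l set" where B: "orthonormal B"
    and parseval: "\<And>x. ((\<lambda>b. (cmod (cinner x b))\<^sup>2) has_sum (norm x)\<^sup>2) B"
    using orthonormal_basis_exists by blast
  define I :: "('j \<times> 'l) set" where "I = UNIV \<times> B"
  have injI: "inj_on \<iota> I"
  proof (rule inj_on_subset[OF inj])
    show "I \<subseteq> {p. snd p \<noteq> 0}"
      using orthonormal_norm[OF B] by (force simp: I_def)
  qed
  define coord where "coord v i =
    (if i \<in> \<iota> ` I then case inv_into I \<iota> i of (j, b) \<Rightarrow> cinner (v j) b else 0)" for v :: "'j \<Rightarrow> 'l" and i
  have coord_in: "coord v (\<iota> (j, b)) = cinner (v j) b" if "b \<in> B" for v j b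
    using that inv_into_f_f[OF injI, of "(j, b)"] by (auto simp: coord_def I_def)
  have coord_out: "coord v i = 0" if "i \<notin> \<iota> ` I" for v i
    using that by (simp add: coord_def)
  have reindex: "(g has_sum S) UNIV \<longleftrightarrow> ((\<lambda>p. g (\<iota> p)) has_sum S) I"
    if "\<And>i. i \<notin> \<iota> ` I \<Longrightarrow> g i = 0" for g :: "'i \<Rightarrow> real" and S
  proof -
    have "(g has_sum S) UNIV \<longleftrightarrow> (g has_sum S) (\<iota> ` I)"
      by (rule has_sum_cong_neutral) (use that in auto)
    then show ?thesis using has_sum_reindex[OF injI] by (simp add: o_def)
  qed
  have coord_sum: "((\<lambda>i. (cmod (coord v i))\<^sup>2) has_sum (\<Sum>\<^sub>\<infinity>j. (norm (v j))\<^sup>2)) UNIV"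
    if v: "square_summable v" for v
  proof -
    have "((\<lambda>(j, b). (cmod (cinner (v j) b))\<^sup>2) has_sum (\<Sum>\<^sub>\<infinity>j. (norm (v j))\<^sup>2)) I"
      unfolding I_def
    proof (rule has_sum_SigmaI)
      show "(\<lambda>(j, b). (cmod (cinner (v j) b))\<^sup>2) summable_on UNIV \<times> B"
        by (rule summable_on_SigmaI[where g = "\<lambda>j. (norm (v j))\<^sup>2"])
          (use parseval v in \<open>auto simp: square_summable_def\<close>)
    qed (use parseval v in \<open>auto simp: square_summable_def\<close>)
    moreover have "((\<lambda>p. (cmod (coord v (\<iota> p)))\<^sup>2) has_sum S) I
        \<longleftrightarrow> ((\<lambda>(j, b). (cmod (cinner (v j) b))\<^sup>2) has_sum S) I" for S
      by (intro has_sum_cong) (auto simp: I_def coord_in)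
    ultimately show ?thesis
      by (subst reindex) (auto simp: coord_out)
  qed
  define family where "family v = Abs_ell2 (coord v)" for v
  have nth: "ell2_nth (family v) i = coord v i" if "square_summable v" for v i
    using has_sum_imp_summable[OF coord_sum[OF that]] by (simp add: family_def Abs_ell2_inverse)
  have norm: "((\<lambda>j. (norm (v j))\<^sup>2) has_sum (norm (family v))\<^sup>2) UNIV"
    if v: "square_summable v" for v
  proof -
    have "(norm (family v))\<^sup>2 = (\<Sum>\<^sub>\<infinity>j. (norm (v j))\<^sup>2)"
      using coord_sum[OF v] by (simp add: ell2_norm_square nth[OF v] infsumI)
    then show ?thesis using v by (simp add: square_summable_def)
  qed
  have add: "family (\<lambda>j. v j + w j) = family v + family w"
    if "square_summable v" "square_summable w" for v w
    by (rule ell2_eqI)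
       (simp add: nth square_summable_add that ell2_nth_simps coord_def cinner_add_left split: prod.split)
  have scale: "family (\<lambda>j. a *\<^sub>C v j) = a *\<^sub>C family v"
    if "square_summable v" for a v
    by (rule ell2_eqI)
       (simp add: nth square_summable_scaleC that ell2_nth_simps coord_def cinner_scaleC_left split: prod.split)
  have diff: "square_summable (\<lambda>j. v j - w j) \<and> family (\<lambda>j. v j - w j) = family v - family w"
    if v: "square_summable v" and w: "square_summable w" for v w
  proof -
    have minus: "(-1) *\<^sub>C x = - x" for x :: "'b::complex_inner"
      using scaleC_of_real[of "-1" x] by simp
    show ?thesis
      using add[OF v square_summable_scaleC[OF w, of "-1"]] scale[OF w, of "-1"]
        square_summable_add[OF v square_summable_scaleC[OF w, of "-1"]]
      by (simp add: minus)
  qed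
  have component_le: "norm (v j) \<le> norm (family v)" if v: "square_summable v" for v j
  proof -
    have "(norm (v j))\<^sup>2 \<le> (norm (family v))\<^sup>2"
      using finite_sum_le_has_sum[OF norm[OF v], of "{j}"] by simp
    then show ?thesis by (rule power2_le_imp_le) simp
  qed
  define K where "K = family ` {v. square_summable v}"
  have inj_family: "inj_on family {v. square_summable v}"
  proof (rule inj_onI, rule ext)
    fix v w j assume "v \<in> {v. square_summable v}" "w \<in> {v. square_summable v}" "family v = family w"
    then show "v j = w j"
      using diff[of v w] component_le[of "\<lambda>j. v j - w j" j] by simp
  qed
  have "closed K"
    unfolding closed_sequential_limits
  proof (intro allI impI, elim conjE)
    fix X x assume "\<forall>n. X n \<in> K" and lim: "X \<longlonglongrightarrow> x"
    then obtain V where V: "\<And>n. square_summable (V n)" "\<And>n. X n = family (V n)"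
      unfolding K_def image_iff by (metis mem_Collect_eq)
    have "Cauchy (\<lambda>n. V n j)" for j
    proof (rule metric_CauchyI)
      fix e :: real assume "0 < e"
      then obtain N where "\<forall>m\<ge>N. \<forall>n\<ge>N. dist (X m) (X n) < e"
        using LIMSEQ_imp_Cauchy[OF lim] metric_CauchyD by blast
      then show "\<exists>M. \<forall>m\<ge>M. \<forall>n\<ge>M. dist (V m j) (V n j) < e"
        using diff[OF V(1) V(1)] component_le V(2) unfolding dist_norm
        by (metis (no_types, lifting) order_le_less_trans)
    qed
    then have "\<forall>j. \<exists>l. (\<lambda>n. V n j) \<longlonglongrightarrow> l"
      using Cauchy_convergent_iff convergent_def by blast
    then obtain v where v: "\<And>j. (\<lambda>n. V n j) \<longlonglongrightarrow> v j" by metis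
    have nth_lim: "(\<lambda>n. ell2_nth (X n) i) \<longlonglongrightarrow> ell2_nth x i" for i
    proof (rule Lim_null_comparison[THEN LIM_zero_cancel])
      show "\<forall>\<^sub>F n in sequentially. norm (ell2_nth (X n) i - ell2_nth x i) \<le> norm (X n - x)"
        using ell2_nth_norm_le[of "X _ - x" i] by (auto simp: ell2_nth_diff)
      show "(\<lambda>n. norm (X n - x)) \<longlonglongrightarrow> 0"
        using lim by (simp add: LIM_zero tendsto_norm_zero)
    qed
    have cinner_lim: "(\<lambda>n. cinner (V n j) b) \<longlonglongrightarrow> cinner (v j) b" for j b
      unfolding cinner_eq_inner by (intro tendsto_Complex tendsto_intros v)
    have x_coord: "ell2_nth x i = coord v i" for i
    proof (cases "i \<in> \<iota> ` I")
      case True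
      then obtain j b where i: "i = \<iota> (j, b)" "b \<in> B" by (auto simp: I_def)
      show ?thesis
        using nth_lim[of i] cinner_lim[of j b] i
        by (simp add: V nth coord_in) (rule LIMSEQ_unique)
    next
      case False
      then show ?thesis
        using nth_lim[of i] by (simp add: V nth coord_out LIMSEQ_const_iff)
    qed
    have "(\<lambda>i. (cmod (coord v i))\<^sup>2) summable_on UNIV"
      using ell2_summable[of x] by (simp add: x_coord)
    then obtain S where "((\<lambda>i. (cmod (coord v i))\<^sup>2) has_sum S) UNIV"
      by (auto simp: summable_on_def)
    then have "((\<lambda>p. (cmod (coord v (\<iota> p)))\<^sup>2) has_sum S) I"
      by (subst (asm) reindex) (auto simp: coord_out)
    moreover have "((\<lambda>p. (cmod (coord v (\<iota> p)))\<^sup>2) has_sum S) I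
        \<longleftrightarrow> ((\<lambda>(j, b). (cmod (cinner (v j) b))\<^sup>2) has_sum S) I"
      by (intro has_sum_cong) (auto simp: I_def coord_in)
    ultimately have "((\<lambda>(j, b). (cmod (cinner (v j) b))\<^sup>2) has_sum S) (UNIV \<times> B)"
      unfolding I_def by simp
    from has_sum_SigmaD[OF this] have "((\<lambda>j. (norm (v j))\<^sup>2) has_sum S) UNIV"
      using parseval by simp
    then have sv: "square_summable v"
      unfolding square_summable_def by (rule has_sum_imp_summable)
    then have "x = family v" by (intro ell2_eqI) (simp add: nth x_coord)
    then show "x \<in> K" using sv by (simp add: K_def)
  qed
  moreover have "complex_vector.subspace K"
  proof (rule complex_vector.subspaceI)
    have z: "square_summable (\<lambda>_. 0 :: 'l)" by (simp add: square_summable_def)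
    have "family (\<lambda>_. 0) = 0"
      by (rule ell2_eqI) (simp add: nth[OF z] coord_def ell2_nth_simps split: prod.split)
    then show "0 \<in> K" using z unfolding K_def by (metis image_eqI mem_Collect_eq)
    show "x + y \<in> K" if "x \<in> K" "y \<in> K" for x y
      using that unfolding K_def
      by (auto simp: add[symmetric] intro!: imageI square_summable_add)
    show "a *\<^sub>C x \<in> K" if "x \<in> K" for a x
      using that unfolding K_def
      by (auto simp: scale[symmetric] intro!: imageI square_summable_scaleC)
  qed
  ultimately have "hilbert_sum K family"
    using inj_family
    by unfold_locales (auto simp: hilbert_subspace_def bij_betw_def K_def add scale norm)
  then show ?thesis by (rule that)
qed

section \<open>Operators on a Hilbert sum\<close>

lemma unitary_pair_norm:
  assumes "unitary_pair U U'"
  shows "norm (U x) = norm x"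
proof -
  have "cinner (U x) (U x) = cinner x x" using assms unfolding unitary_pair_def by metis
  then have "(norm (U x))\<^sup>2 = (norm x)\<^sup>2" by (simp add: cinner_self flip: of_real_power)
  then show ?thesis by simp
qed

lemma unitary_pair_swap:
  assumes "unitary_pair U U'"
  shows "unitary_pair U' U"
  using assms unfolding unitary_pair_def by (metis cinner_commute)

lemma op_norm_le:
  assumes "H \<noteq> {}" "0 \<le> M" "\<And>x. x \<in> H \<Longrightarrow> norm (A x) \<le> M * norm x"
  shows "op_norm H A \<le> M"
  unfolding op_norm_def
proof (rule cSUP_least[OF assms(1)])
  show "norm (A x) / norm x \<le> M" if "x \<in> H" for x
    using assms(2) assms(3)[OF that] by (cases "norm x = 0") (auto simp: field_simps)
qed

text \<open>On the zero vector the quotient in the operator norm is \<open>0\<close>, so a negative bound has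
  to be replaced by \<open>0\<close>.\<close>

lemma bounded_op_bdd_above:
  assumes "bounded_op H A"
  shows "bdd_above ((\<lambda>x. norm (A x) / norm x) ` H)"
proof -
  obtain M where M: "\<And>x. x \<in> H \<Longrightarrow> norm (A x) \<le> M * norm x"
    using assms unfolding bounded_op_def by blast
  have "norm (A y) / norm y \<le> max M 0" if "y \<in> H" for y
  proof (cases "norm y = 0")
    case False
    then have "norm (A y) / norm y \<le> M" using M[OF that] by (simp add: field_simps)
    then show ?thesis by simp
  qed simp
  then show ?thesis by (intro bdd_aboveI[of _ "max M 0"]) auto
qed

lemma bounded_op_norm_le:
  assumes "bounded_op H A" "x \<in> H"
  shows "norm (A x) \<le> op_norm H A * norm x"
proof (cases "x = 0")
  case True
  have "norm (A x) \<le> 0"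
    using assms True unfolding bounded_op_def by (metis mult_zero_right norm_zero)
  then show ?thesis using True by simp
next
  case False
  have "norm (A x) / norm x \<le> op_norm H A"
    unfolding op_norm_def by (rule cSUP_upper[OF assms(2) bounded_op_bdd_above[OF assms(1)]])
  then show ?thesis using False by (simp add: field_simps)
qed

lemma op_norm_nonneg:
  assumes "bounded_op H A" "0 \<in> H"
  shows "0 \<le> op_norm H A"
proof -
  have "norm (A 0) / norm (0 :: 'a) \<le> op_norm H A"
    unfolding op_norm_def by (rule cSUP_upper[OF assms(2) bounded_op_bdd_above[OF assms(1)]])
  then show ?thesis by simp
qed

lemma normal_opI:
  assumes bounded: "bounded_op K A" and K: "complex_vector.subspace K"
    and closed: "\<And>x. x \<in> K \<Longrightarrow> A' x \<in> K"
    and adj: "\<And>x y. x \<in> K \<Longrightarrow> y \<in> K \<Longrightarrow> cinner (A x) y = cinner x (A' y)"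
    and comm: "\<And>x. x \<in> K \<Longrightarrow> A (A' x) = A' (A x)"
  shows "normal_op K A"
proof -
  have AK: "A x \<in> K" if "x \<in> K" for x
    using bounded that unfolding bounded_op_def by blast
  have "adjoint_op K A y = A' y" if y: "y \<in> K" for y
    unfolding adjoint_op_def
  proof (rule the_equality)
    show "A' y \<in> K \<and> (\<forall>x\<in>K. cinner (A x) y = cinner x (A' y))"
      using y closed adj by blast
    fix z assume z: "z \<in> K \<and> (\<forall>x\<in>K. cinner (A x) y = cinner x z)"
    then have "z - A' y \<in> K"
      using closed[OF y] K by (simp add: complex_vector.subspace_diff)
    then have "cinner (z - A' y) z = cinner (z - A' y) (A' y)"
      using z adj y by metis
    then have "cinner (z - A' y) (z - A' y) = 0" by (simp add: cinner_diff_right)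
    then show "z = A' y" by (simp add: cinner_self)
  qed
  then show ?thesis
    using bounded comm closed AK by (simp add: normal_op_def)
qed

text \<open>In contrast to \<open>unitary_pair\<close>, the inverse is quantified away: for the dilation it only
  serves to establish normality.\<close>

definition unitary_on :: "'a::complex_inner set \<Rightarrow> ('a \<Rightarrow> 'a) \<Rightarrow> bool" where
  "unitary_on K A \<longleftrightarrow> clinear_on K A \<and>
     (\<exists>A'. (\<forall>x\<in>K. A x \<in> K \<and> A' x \<in> K \<and> A (A' x) = x \<and> A' (A x) = x) \<and>
       (\<forall>x\<in>K. \<forall>y\<in>K. cinner (A x) y = cinner x (A' y)))"

text \<open>The scaling is needed because the dilation itself consists of multiples of unitaries.\<close>

lemma unitary_on_imp_scaled_normal:
  fixes A :: "'a::complex_inner \<Rightarrow> 'a" and r :: real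
  assumes K: "complex_vector.subspace K" and A: "unitary_on K A" and r: "0 \<le> r"
  shows "normal_op K (\<lambda>x. r *\<^sub>R A x)" "op_norm K (\<lambda>x. r *\<^sub>R A x) \<le> r"
proof -
  obtain A' where lin: "clinear_on K A"
    and A': "\<And>x. x \<in> K \<Longrightarrow> A x \<in> K" "\<And>x. x \<in> K \<Longrightarrow> A' x \<in> K"
      "\<And>x. x \<in> K \<Longrightarrow> A (A' x) = x" "\<And>x. x \<in> K \<Longrightarrow> A' (A x) = x"
    and adj: "\<And>x y. x \<in> K \<Longrightarrow> y \<in> K \<Longrightarrow> cinner (A x) y = cinner x (A' y)"
    using A unfolding unitary_on_def by blast
  have scale: "r *\<^sub>R x \<in> K" if "x \<in> K" for x
    using complex_subspace_imp_subspace[OF K] that by (rule subspace_scale)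
  have A_scale: "A (r *\<^sub>R x) = r *\<^sub>R A x" if "x \<in> K" for x
    using lin that unfolding clinear_on_def by (metis scaleC_of_real)
  have A'_scale: "A' (r *\<^sub>R x) = r *\<^sub>R A' x" if "x \<in> K" for x
    using A_scale[of "A' x"] A' that scale by metis
  have norm_A: "norm (A x) = norm x" if "x \<in> K" for x
  proof -
    have "cinner (A x) (A x) = cinner x x" using adj A' that by simp
    then have "(norm (A x))\<^sup>2 = (norm x)\<^sup>2" by (simp add: cinner_self flip: of_real_power)
    then show ?thesis by simp
  qed
  have "clinear_on K (\<lambda>x. r *\<^sub>R A x)"
    using lin unfolding clinear_on_def
    by (simp add: scaleR_add_right) (metis scaleC_of_real scaleC_scaleC mult.commute)
  moreover have "norm (r *\<^sub>R A x) \<le> r * norm x" if "x \<in> K" for x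
    using norm_A[OF that] r by simp
  ultimately have "bounded_op K (\<lambda>x. r *\<^sub>R A x)"
    unfolding bounded_op_def using A'(1) scale by blast
  then show "normal_op K (\<lambda>x. r *\<^sub>R A x)"
    using K by (rule normal_opI[where A' = "\<lambda>x. r *\<^sub>R A' x"])
      (simp_all add: A' scale A_scale A'_scale adj cinner_scaleR_left cinner_scaleR_right)
  show "op_norm K (\<lambda>x. r *\<^sub>R A x) \<le> r"
    using complex_vector.subspace_0[OF K] r norm_A by (intro op_norm_le) auto
qed

context hilbert_sum
begin

lemma family_in: "square_summable v \<Longrightarrow> family v \<in> K"
  using family_bij by (auto simp: bij_betw_def)

lemma family_cinner:
  assumes v: "square_summable v" and w: "square_summable w"
  shows "((\<lambda>j. cinner (v j) (w j)) has_sum cinner (family v) (family w)) UNIV"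
proof -
  have polar: "inner x y = (1/2) * ((norm (x + y))\<^sup>2 + (-1) * (norm x)\<^sup>2 + (-1) * (norm y)\<^sup>2)"
    for x y :: "'x::real_inner"
    unfolding power2_norm_eq_inner by (simp add: inner_add inner_commute)
  have real: "((\<lambda>j. inner (v j) (w j)) has_sum inner (family v) (family w)) UNIV"
    if w: "square_summable w" for w
    unfolding polar family_add[OF v w, symmetric]
    by (intro has_sum_cmult_right has_sum_add family_norm square_summable_add v w)
  have "((\<lambda>j. inner (v j) (\<i> *\<^sub>C w j)) has_sum inner (family v) (\<i> *\<^sub>C family w)) UNIV"
    using real[OF square_summable_scaleC[OF w, of \<i>]] by (simp add: family_scaleC w)
  then have "((\<lambda>j. complex_of_real (inner (v j) (w j)) + \<i> * complex_of_real (inner (v j) (\<i> *\<^sub>C w j)))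
      has_sum (complex_of_real (inner (family v) (family w))
        + \<i> * complex_of_real (inner (family v) (\<i> *\<^sub>C family w)))) UNIV"
    by (intro has_sum_add has_sum_cmult_right has_sum_of_real real w)
  then show ?thesis by (simp add: cinner_eq_inner Complex_eq)
qed

definition component :: "'k \<Rightarrow> 'j \<Rightarrow> 'l" where
  "component = inv_into {v. square_summable v} family"

lemma component_family: "square_summable v \<Longrightarrow> component (family v) = v"
  using family_bij by (simp add: component_def bij_betw_def)

lemma family_cases:
  assumes "x \<in> K"
  obtains v where "square_summable v" "x = family v"
  using assms family_bij by (auto simp: bij_betw_def)

text \<open>The counterpart of a matrix with one unitary entry in each row and column.\<close>

definition monomial_op :: "('j \<Rightarrow> 'j) \<Rightarrow> ('j \<Rightarrow> 'l \<Rightarrow> 'l) \<Rightarrow> 'k \<Rightarrow> 'k" where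
  "monomial_op p U x = family (\<lambda>j. U j (component x (p j)))"

lemma monomial_op_family:
  "square_summable v \<Longrightarrow> monomial_op p U (family v) = family (\<lambda>j. U j (v (p j)))"
  by (simp add: monomial_op_def component_family)

lemma square_summable_monomial:
  fixes v :: "'j \<Rightarrow> 'l"
  assumes p: "bij p" and U: "\<And>j. unitary_pair (U j) (U' j)" and v: "square_summable v"
  shows "square_summable (\<lambda>j. U j (v (p j)))"
  using v summable_on_reindex_bij_betw[OF p, of "\<lambda>j. (norm (v j))\<^sup>2"]
  by (simp add: square_summable_def unitary_pair_norm[OF U])

lemma monomial_op_unitary:
  assumes p: "bij p" and U: "\<And>j. unitary_pair (U j) (U' j)"
  shows "unitary_on K (monomial_op p U)"
proof -
  let ?q = "inv p"
  let ?A = "monomial_op p U" and ?A' = "monomial_op ?q (\<lambda>j. U' (?q j))"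
  have q: "bij ?q" using p by (rule bij_imp_bij_inv)
  have pq: "p (?q j) = j" and qp: "?q (p j) = j" for j
    using p by (simp_all add: bij_is_surj surj_f_inv_f bij_is_inj inv_f_f)
  have lin: "U j (x + y) = U j x + U j y" "U j (a *\<^sub>C x) = a *\<^sub>C U j x"
    and cadj: "cinner (U j x) y = cinner x (U' j y)"
    and UU': "U j (U' j x) = x" "U' j (U j x) = x" for j x y a
    using U[of j] by (auto simp: unitary_pair_def clinear_on_def)
  have ss: "square_summable (\<lambda>j. U j (v (p j)))" "square_summable (\<lambda>j. U' (?q j) (v (?q j)))"
    if "square_summable v" for v
    using square_summable_monomial[OF p U that]
      square_summable_monomial[OF q unitary_pair_swap[OF U] that] .
  have "clinear_on K ?A"
    unfolding clinear_on_def
  proof (intro conjI ballI allI)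
    fix x y assume "x \<in> K" "y \<in> K"
    obtain v where "square_summable v" "x = family v" using \<open>x \<in> K\<close> by (rule family_cases)
    moreover obtain w where "square_summable w" "y = family w"
      using \<open>y \<in> K\<close> by (rule family_cases)
    ultimately show "?A (x + y) = ?A x + ?A y"
      by (simp add: family_add[symmetric] monomial_op_family square_summable_add lin ss)
  next
    fix a x assume "x \<in> K"
    then obtain v where "square_summable v" "x = family v" by (rule family_cases)
    then show "?A (a *\<^sub>C x) = a *\<^sub>C ?A x"
      by (simp add: family_scaleC[symmetric] monomial_op_family square_summable_scaleC lin ss)
  qed
  moreover have "?A x \<in> K \<and> ?A' x \<in> K \<and> ?A (?A' x) = x \<and> ?A' (?A x) = x" if "x \<in> K" for x
    using that by (auto elim!: family_cases simp: monomial_op_family ss family_in UU' pq qp)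
  moreover have "cinner (?A x) y = cinner x (?A' y)" if xy: "x \<in> K" "y \<in> K" for x y
  proof -
    obtain v where v: "square_summable v" "x = family v" using xy(1) by (rule family_cases)
    obtain w where w: "square_summable w" "y = family w" using xy(2) by (rule family_cases)
    have "((\<lambda>j. cinner (v (p j)) (U' j (w j))) has_sum cinner (?A x) y) UNIV"
      using family_cinner[OF ss(1)[OF v(1)] w(1)] by (simp add: v w monomial_op_family cadj)
    moreover have "((\<lambda>j. cinner (v j) (U' (?q j) (w (?q j)))) has_sum cinner x (?A' y)) UNIV"
      using family_cinner[OF v(1) ss(2)[OF w(1)]] by (simp add: v w monomial_op_family)
    then have "((\<lambda>j. cinner (v (p j)) (U' j (w j))) has_sum cinner x (?A' y)) UNIV"
      using has_sum_reindex_bij_betw[OF p, of "\<lambda>j. cinner (v j) (U' (?q j) (w (?q j)))"]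
      by (simp add: qp)
    ultimately show ?thesis by (rule has_sum_unique)
  qed
  ultimately show ?thesis unfolding unitary_on_def by blast
qed

end

text \<open>The compression is tested by inner products with vectors in the range of \<open>V\<close>, so that no
  projection has to be computed.\<close>

lemma compression_ofI:
  assumes H: "complex_vector.subspace H" and A: "\<And>x. x \<in> H \<Longrightarrow> A x \<in> H"
    and V: "clinear_on H V" "\<And>x y. x \<in> H \<Longrightarrow> y \<in> H \<Longrightarrow> cinner (V x) (V y) = cinner x y"
    and comp: "\<And>x y. x \<in> H \<Longrightarrow> y \<in> H \<Longrightarrow> cinner (B (V x)) (V y) = cinner (A x) y"
  shows "compression_of H V A B"
  unfolding compression_of_def
proof
  fix x assume x: "x \<in> H"
  have orth: "cinner (B (V x) - V (A x)) (V z) = 0" if "z \<in> H" for z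
    using comp[OF x that] V(2)[OF A[OF x] that] by (simp add: cinner_diff_left)
  have V_diff: "V u - V w = V (u - w)" if "u \<in> H" "w \<in> H" for u w
  proof -
    have "u - w \<in> H" using H that by (rule complex_vector.subspace_diff)
    then have "V ((u - w) + w) = V (u - w) + V w"
      using V(1) that unfolding clinear_on_def by blast
    then show ?thesis by simp
  qed
  have "orth_proj (V ` H) (B (V x)) = V (A x)"
    unfolding orth_proj_def
  proof (rule the_equality)
    show "V (A x) \<in> V ` H \<and> (\<forall>z\<in>V ` H. cinner (B (V x) - V (A x)) z = 0)"
      using orth A[OF x] by auto
    fix y assume y: "y \<in> V ` H \<and> (\<forall>z\<in>V ` H. cinner (B (V x) - y) z = 0)"
    then obtain u where u: "u \<in> H" "y = V u" by blast
    have "V (A x) - y = V (A x - u)" and d: "A x - u \<in> H"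
      using u A[OF x] V_diff H by (auto intro: complex_vector.subspace_diff)
    then have "cinner (B (V x) - y) (V (A x) - y) = 0"
      and "cinner (B (V x) - V (A x)) (V (A x) - y) = 0"
      using y orth[OF d] by auto
    then have "cinner (V (A x) - y) (V (A x) - y) = 0"
      by (simp add: cinner_diff_left)
    then show "y = V (A x)" by (simp add: cinner_self)
  qed
  then show "V (A x) = orth_proj (V ` H) (B (V x))" ..
qed

section \<open>The comb\<close>

lemma has_sum_int_halves:
  fixes f :: "int \<Rightarrow> real"
  assumes "((\<lambda>n. f (int n)) has_sum a) UNIV" "((\<lambda>n. f (- 1 - int n)) has_sum b) UNIV"
  shows "(f has_sum (a + b)) UNIV"
proof -
  have "bij_betw int UNIV {0..}"
    by (rule bij_betwI[where g = nat]) auto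
  then have "(f has_sum a) {0..}"
    using assms(1) has_sum_reindex_bij_betw[of int UNIV "{0..}" f a] by simp
  moreover have "bij_betw (\<lambda>n. - 1 - int n) UNIV {..<0}"
    by (rule bij_betwI[where g = "\<lambda>y. nat (- 1 - y)"]) auto
  then have "(f has_sum b) {..<0}"
    using assms(2) has_sum_reindex_bij_betw[of "\<lambda>n. - 1 - int n" UNIV "{..<0}" f b] by simp
  ultimately have "(f has_sum (a + b)) ({0..} \<union> {..<0})"
    by (rule has_sum_Un_disjoint) auto
  moreover have "{0..} \<union> {..<0} = (UNIV :: int set)" by auto
  ultimately show ?thesis by simp
qed

lemma has_sum_geometric:
  fixes q :: real
  assumes "0 \<le> q" "q < 1"
  shows "((\<lambda>n. c * q ^ n) has_sum (c / (1 - q))) UNIV"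
proof -
  have "((\<lambda>n. q ^ n) has_sum (1 / (1 - q))) UNIV"
    using assms by (intro sums_nonneg_imp_has_sum geometric_sums) auto
  from has_sum_cmult_right[OF this, of c] show ?thesis by simp
qed

text \<open>The next two sums are the square norm of the eigenvector on one tooth and the contribution of
  the edges of one tooth to the adjacency form, both for the value \<open>1\<close> at the spine.\<close>

lemma has_sum_tooth_norm:
  fixes \<mu> :: real
  assumes "0 \<le> \<mu>" "\<mu> < 1"
  shows "((\<lambda>y :: int. (\<mu> ^ nat \<bar>y\<bar>)\<^sup>2) has_sum ((1 + \<mu>\<^sup>2) / (1 - \<mu>\<^sup>2))) UNIV"
proof -
  have q: "0 \<le> \<mu>\<^sup>2" "\<mu>\<^sup>2 < 1" using assms by (auto simp: power_less_one_iff)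
  have "((\<lambda>y :: int. (\<mu> ^ nat \<bar>y\<bar>)\<^sup>2) has_sum (1 / (1 - \<mu>\<^sup>2) + \<mu>\<^sup>2 / (1 - \<mu>\<^sup>2))) UNIV"
  proof (rule has_sum_int_halves)
    show "((\<lambda>n. (\<mu> ^ nat \<bar>int n\<bar>)\<^sup>2) has_sum (1 / (1 - \<mu>\<^sup>2))) UNIV"
      using has_sum_geometric[OF q, of 1] by (simp add: power_mult[symmetric] mult.commute)
    have "(\<mu> ^ nat \<bar>- 1 - int n\<bar>)\<^sup>2 = \<mu>\<^sup>2 * (\<mu>\<^sup>2) ^ n" for n
    proof -
      have "nat \<bar>- 1 - int n\<bar> = Suc n" by simp
      then show ?thesis by (simp add: power_mult_distrib power_mult[symmetric] mult.commute)
    qed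
    then show "((\<lambda>n. (\<mu> ^ nat \<bar>- 1 - int n\<bar>)\<^sup>2) has_sum (\<mu>\<^sup>2 / (1 - \<mu>\<^sup>2))) UNIV"
      using has_sum_geometric[OF q, of "\<mu>\<^sup>2"] by simp
  qed
  then show ?thesis by (simp add: add_divide_distrib)
qed

lemma has_sum_tooth_edges:
  fixes \<mu> :: real
  assumes "0 \<le> \<mu>" "\<mu> < 1"
  shows "((\<lambda>y :: int. \<mu> ^ nat \<bar>y + 1\<bar> * \<mu> ^ nat \<bar>y\<bar>) has_sum (2 * \<mu> / (1 - \<mu>\<^sup>2))) UNIV"
proof -
  have q: "0 \<le> \<mu>\<^sup>2" "\<mu>\<^sup>2 < 1" using assms by (auto simp: power_less_one_iff)
  have "((\<lambda>y :: int. \<mu> ^ nat \<bar>y + 1\<bar> * \<mu> ^ nat \<bar>y\<bar>) has_sum (\<mu> / (1 - \<mu>\<^sup>2) + \<mu> / (1 - \<mu>\<^sup>2))) UNIV"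
  proof (rule has_sum_int_halves)
    have sq: "\<mu> ^ n * \<mu> ^ n = (\<mu>\<^sup>2) ^ n" for n
      by (simp add: power2_eq_square power_mult_distrib)
    have "\<mu> ^ nat \<bar>int n + 1\<bar> * \<mu> ^ nat \<bar>int n\<bar> = \<mu> * (\<mu>\<^sup>2) ^ n" for n
    proof -
      have "nat \<bar>int n + 1\<bar> = Suc n" by simp
      then show ?thesis by (simp add: sq)
    qed
    then show "((\<lambda>n. \<mu> ^ nat \<bar>int n + 1\<bar> * \<mu> ^ nat \<bar>int n\<bar>) has_sum (\<mu> / (1 - \<mu>\<^sup>2))) UNIV"
      using has_sum_geometric[OF q, of \<mu>] by simp
    have "\<mu> ^ nat \<bar>- 1 - int n + 1\<bar> * \<mu> ^ nat \<bar>- 1 - int n\<bar> = \<mu> * (\<mu>\<^sup>2) ^ n" for n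
    proof -
      have "nat \<bar>- 1 - int n + 1\<bar> = n" "nat \<bar>- 1 - int n\<bar> = Suc n" by simp_all
      then show ?thesis by (simp add: sq)
    qed
    then show "((\<lambda>n. \<mu> ^ nat \<bar>- 1 - int n + 1\<bar> * \<mu> ^ nat \<bar>- 1 - int n\<bar>)
        has_sum (\<mu> / (1 - \<mu>\<^sup>2))) UNIV"
      using has_sum_geometric[OF q, of \<mu>] by simp
  qed
  then show ?thesis by simp
qed

lemma has_sum_two_combs:
  fixes f :: "bool \<times> int \<times> bool \<Rightarrow> real"
  assumes "\<And>r s. ((\<lambda>y. f (r, y, s)) has_sum S r s) UNIV"
  shows "(f has_sum (S True True + S True False + S False True + S False False)) UNIV"
proof -
  let ?R = "\<lambda>r s. range (\<lambda>y :: int. (r :: bool, y, s :: bool))"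
  have part: "(f has_sum S r s) (?R r s)" for r s
    by (subst has_sum_reindex) (auto simp: inj_on_def o_def assms)
  have "(f has_sum (S True True + S True False + S False True + S False False))
      (?R True True \<union> ?R True False \<union> ?R False True \<union> ?R False False)"
    by (intro has_sum_Un_disjoint part) auto
  moreover have "?R True True \<union> ?R True False \<union> ?R False True \<union> ?R False False = UNIV"
    by (auto simp: image_iff)
  ultimately show ?thesis by simp
qed

text \<open>
  These are the numbers \<open>\<mu>\<close>, \<open>e\<close> and \<open>o\<close> of the eigenvector of the comb for \<open>\<lambda> = 2 \<surd>\<phi>\<close>. The equations
  \<open>\<lambda> o = 2 e\<close> and \<open>\<lambda> e = 2 o + 2 \<mu> e\<close> give \<open>o = e / \<surd>\<phi>\<close> and \<open>\<mu> = \<surd>\<phi> - 1 / \<surd>\<phi> = \<phi>\<^sup>-\<^sup>3\<^sup>/\<^sup>2\<close>, and \<open>e\<close> is fixed by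
  the normalization \<open>comb_norm\<close>.
\<close>

definition decay :: real where "decay = 1 / (golden_ratio * sqrt golden_ratio)"
definition even_weight :: real where "even_weight = 1 / sqrt (sqrt 5)"
definition odd_weight :: real where "odd_weight = even_weight / sqrt golden_ratio"

lemma golden_ratio_pos: "golden_ratio > 1"
  by (simp add: golden_ratio_def)

lemma golden_ratio_square: "golden_ratio\<^sup>2 = golden_ratio + 1"
  by (simp add: golden_ratio_def power2_eq_square field_simps)

lemma sqrt_5_golden_ratio: "sqrt 5 = 2 * golden_ratio - 1"
  by (simp add: golden_ratio_def field_simps)

lemma golden_ratio_edges: "sqrt 5 * golden_ratio = golden_ratio + 2"
  using golden_ratio_square unfolding sqrt_5_golden_ratio power2_eq_square
  by (simp add: algebra_simps)

lemma decay_bounds: "0 < decay" "decay < 1"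
proof -
  have "1 < sqrt golden_ratio" using golden_ratio_pos by simp
  then have "1 * 1 < golden_ratio * sqrt golden_ratio"
    using golden_ratio_pos by (intro mult_strict_mono) auto
  then show "0 < decay" "decay < 1" by (simp_all add: decay_def)
qed

lemma one_minus_decay_square: "1 - decay\<^sup>2 = 2 / golden_ratio\<^sup>2"
proof -
  have pos: "golden_ratio > 0" using golden_ratio_pos by simp
  have cube: "golden_ratio ^ 3 = 2 * golden_ratio + 1"
    using golden_ratio_square by (simp add: power3_eq_cube power2_eq_square algebra_simps)
  have "decay\<^sup>2 = 1 / golden_ratio ^ 3"
    using pos by (simp add: decay_def power_divide power_mult_distrib power3_eq_cube power2_eq_square)
  then have "1 - decay\<^sup>2 = (golden_ratio ^ 3 - 1) / golden_ratio ^ 3"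
    using pos by (simp add: field_simps)
  also have "\<dots> = 2 * golden_ratio / golden_ratio ^ 3" by (simp add: cube)
  also have "\<dots> = 2 / golden_ratio\<^sup>2" using pos by (simp add: power3_eq_cube power2_eq_square)
  finally show ?thesis .
qed

lemma even_weight_square: "even_weight\<^sup>2 = 1 / sqrt 5"
  by (simp add: even_weight_def power_divide)

lemma odd_weight_square: "odd_weight\<^sup>2 = 1 / (golden_ratio * sqrt 5)"
  using golden_ratio_pos by (simp add: odd_weight_def power_divide even_weight_square)

text \<open>The mass of one folded comb: an even point with its tooth, and an odd point.\<close>

lemma comb_norm:
  "even_weight\<^sup>2 * ((1 + decay\<^sup>2) / (1 - decay\<^sup>2)) + odd_weight\<^sup>2 = 1"
proof -
  have pos: "golden_ratio > 0" using golden_ratio_pos by simp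
  have "1 + decay\<^sup>2 = 2 - 2 / golden_ratio\<^sup>2" using one_minus_decay_square by simp
  then have "(1 + decay\<^sup>2) / (1 - decay\<^sup>2) = golden_ratio\<^sup>2 - 1"
    using pos unfolding one_minus_decay_square by (simp add: field_simps)
  then have "(1 + decay\<^sup>2) / (1 - decay\<^sup>2) = golden_ratio"
    by (simp add: golden_ratio_square)
  then have "even_weight\<^sup>2 * ((1 + decay\<^sup>2) / (1 - decay\<^sup>2)) + odd_weight\<^sup>2
      = 1 / sqrt 5 * golden_ratio + 1 / (golden_ratio * sqrt 5)"
    by (simp only: even_weight_square odd_weight_square)
  also have "\<dots> = (golden_ratio\<^sup>2 + 1) / (sqrt 5 * golden_ratio)"
    using pos by (simp add: field_simps power2_eq_square)
  also have "\<dots> = 1" using pos by (simp add: golden_ratio_square golden_ratio_edges)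
  finally show ?thesis .
qed

text \<open>Half of the contribution \<open>2 e o\<close> of the spine plus half of that of a tooth: this is
  the factor by which the compression of either operator is scaled when two combs share the mass.\<close>

lemma comb_edges:
  "even_weight * odd_weight + even_weight\<^sup>2 * (decay / (1 - decay\<^sup>2)) = sqrt golden_ratio / 2"
proof -
  define s where "s = sqrt golden_ratio"
  have pos: "golden_ratio > 0" "s > 0" and ss: "golden_ratio = s * s"
    using golden_ratio_pos by (auto simp: s_def)
  have "decay / (1 - decay\<^sup>2) = golden_ratio / (2 * s)"
    unfolding one_minus_decay_square unfolding decay_def s_def[symmetric]
    using pos by (simp add: power2_eq_square field_simps)
  moreover have "even_weight * odd_weight = even_weight\<^sup>2 / s"
    by (simp add: odd_weight_def s_def power2_eq_square)
  ultimately have "even_weight * odd_weight + even_weight\<^sup>2 * (decay / (1 - decay\<^sup>2))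
      = 1 / sqrt 5 / s + 1 / sqrt 5 * (golden_ratio / (2 * s))"
    by (simp only: even_weight_square)
  also have "\<dots> = (golden_ratio + 2) / (2 * s * sqrt 5)"
    using pos by (simp add: field_simps)
  also have "\<dots> = golden_ratio / (2 * s)"
    using pos unfolding golden_ratio_edges[symmetric] by (simp add: field_simps)
  also have "\<dots> = s / 2" using pos ss by (simp add: field_simps)
  finally show ?thesis by (simp add: s_def)
qed

section \<open>Dilation of a pair of unitaries\<close>

definition unitary_power :: "('a \<Rightarrow> 'a) \<Rightarrow> ('a \<Rightarrow> 'a) \<Rightarrow> int \<Rightarrow> 'a \<Rightarrow> 'a" where
  "unitary_power U U' y = (if 0 \<le> y then U ^^ nat y else U' ^^ nat (- y))"

lemma unitary_pair_id: "unitary_pair id id"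
  by (simp add: unitary_pair_def clinear_on_def)

lemma unitary_pair_funpow:
  assumes "unitary_pair U U'"
  shows "unitary_pair (U ^^ n) (U' ^^ n)"
proof (induction n)
  case 0
  then show ?case using unitary_pair_id by (simp add: id_def)
next
  case (Suc n)
  have swap: "(U' ^^ Suc n) x = (U' ^^ n) (U' x)" for x by (simp add: funpow_swap1)
  show ?case
    using Suc assms unfolding unitary_pair_def swap clinear_on_def by simp
qed

lemma unitary_pair_power:
  assumes "unitary_pair U U'"
  shows "\<exists>W'. unitary_pair (unitary_power U U' y) W'"
  using unitary_pair_funpow[OF assms] unitary_pair_funpow[OF unitary_pair_swap[OF assms]]
  unfolding unitary_power_def by (metis (full_types))

text \<open>Moving by one step along a tooth amounts to applying \<open>U\<close> first. This is what makes all edges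
  of a tooth contribute the same operator \<open>U\<close>.\<close>

lemma unitary_power_step:
  assumes "unitary_pair U U'"
  shows "unitary_power U U' (y + 1) x = unitary_power U U' y (U x)"
proof (cases "0 \<le> y")
  case True
  then have "nat (y + 1) = Suc (nat y)" by simp
  then show ?thesis using True by (simp add: unitary_power_def funpow_swap1)
next
  case False
  then have "nat (- y) = Suc (nat (- (y + 1)))" by simp
  moreover have "U' (U x) = x" using assms by (simp add: unitary_pair_def)
  ultimately show ?thesis using False
    by (auto simp: unitary_power_def funpow_swap1[symmetric] simp del: funpow.simps(2)
        simp add: funpow_Suc_right)
qed

text \<open>
  In the index \<open>(r, y, s)\<close>, \<open>r\<close> tells which of the two combs is meant, by naming the operator that
  acts along its spine; \<open>y\<close> is the height on a tooth; and \<open>s\<close> separates the even points of the spine with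
  their teeth from the odd points. The operator \<open>N c\<close> exchanges the two classes and applies \<open>U c\<close> on the comb
  \<open>c\<close>, and shifts along the tooth on the other comb. On odd points the vector \<open>V x\<close> vanishes unless
  \<open>y = 0\<close>, since there is no tooth; the indices with \<open>y \<noteq> 0\<close> are kept to make the shift unitary.
\<close>

lemma comb_dilation:
  fixes family :: "(bool \<times> int \<times> bool \<Rightarrow> 'l::complex_hilbert_space) \<Rightarrow> 'k::complex_hilbert_space"
    and U U' :: "bool \<Rightarrow> 'l \<Rightarrow> 'l"
  assumes K: "hilbert_sum K family" and U: "\<And>c. unitary_pair (U c) (U' c)"
  shows "\<exists>(V :: 'l \<Rightarrow> 'k) N. clinear_on UNIV V \<and> range V \<subseteq> K \<and>
    (\<forall>x y. cinner (V x) (V y) = cinner x y) \<and>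
    (\<forall>c. unitary_on K (N c)) \<and> (\<forall>c c'. commute_on K (N c) (N c')) \<and>
    (\<forall>c x y. cinner (N c (V x)) (V y) = (sqrt golden_ratio / 2) * cinner (U c x) y)"
proof -
  interpret hilbert_sum K family by (rule K)
  note \<mu> = less_imp_le[OF decay_bounds(1)] decay_bounds(2)
  define p where "p c = (\<lambda>(r, y :: int, s). if r = c then (r, y, \<not> s) else (r, y + 1, s))"
    for c :: bool
  have p: "p c (r, y, s) = (if r = c then (r, y, \<not> s) else (r, y + 1, s))" for c r y s
    by (simp add: p_def)
  have bij_p: "bij (p c)" for c
  proof (rule bij_betwI[where g = "\<lambda>(r, y :: int, s). if r = c then (r, y, \<not> s) else (r, y - 1, s)"])
  qed (auto simp: p_def split: prod.split)
  define M where "M c = (\<lambda>(r, y :: int, s :: bool). if r = c then U c else id)" for c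
  define M' where "M' c = (\<lambda>(r, y :: int, s :: bool). if r = c then U' c else id)" for c
  have M: "unitary_pair (M c j) (M' c j)" for c j
    using U unitary_pair_id by (auto simp: M_def M'_def split: prod.split)
  define N where "N c = monomial_op (p c) (M c)" for c
  define w where "w = (\<lambda>(r :: bool, y :: int, s). (1 / sqrt 2) *
      (if s then even_weight * decay ^ nat \<bar>y\<bar> else if y = 0 then odd_weight else 0))"
  define W where "W = (\<lambda>(r, y, s). if s then unitary_power (U (\<not> r)) (U' (\<not> r)) y else id)"
  define v where "v x j = w j *\<^sub>R W j x" for x j
  define V where "V x = family (v x)" for x
  have W_pair: "\<exists>W'. unitary_pair (W j) W'" for j
    using unitary_pair_power[OF U] unitary_pair_id by (auto simp: W_def split: prod.split)
  have W_cinner: "cinner (W j x) (W j y) = cinner x y" and W_norm: "norm (W j x) = norm x"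
    and W_add: "W j (x + y) = W j x + W j y" and W_scale: "W j (a *\<^sub>C x) = a *\<^sub>C W j x" for j x y a
  proof -
    obtain W' where W': "unitary_pair (W j) W'" using W_pair by blast
    show "cinner (W j x) (W j y) = cinner x y" "norm (W j x) = norm x"
      "W j (x + y) = W j x + W j y" "W j (a *\<^sub>C x) = a *\<^sub>C W j x"
      using W' unitary_pair_norm[OF W'] by (simp_all add: unitary_pair_def clinear_on_def)
  qed
  have w_sum: "((\<lambda>j. (w j)\<^sup>2) has_sum 1) UNIV"
  proof -
    define S where "S s = (if s then (1/2) * (even_weight\<^sup>2 * ((1 + decay\<^sup>2) / (1 - decay\<^sup>2)))
        else (1/2) * odd_weight\<^sup>2)" for s
    have "((\<lambda>y. (w (r, y, s))\<^sup>2) has_sum S s) UNIV" for r s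
    proof (cases s)
      case True
      have "((\<lambda>y :: int. (1/2) * (even_weight\<^sup>2 * (decay ^ nat \<bar>y\<bar>)\<^sup>2)) has_sum S s) UNIV"
        unfolding S_def using True by (simp only: if_True) (intro has_sum_cmult_right has_sum_tooth_norm \<mu>)
      then show ?thesis using True by (simp add: w_def power_mult_distrib power_divide)
    next
      case False
      have "((\<lambda>y :: int. (w (r, y, s))\<^sup>2) has_sum S s) {0}"
        using False by (simp add: w_def S_def power_mult_distrib power_divide has_sum_finiteI)
      then show ?thesis
        by (subst has_sum_cong_neutral[where S = UNIV and T = "{0}"]) (use False in \<open>auto simp: w_def\<close>)
    qed
    from has_sum_two_combs[OF this]
    have "((\<lambda>j. (w j)\<^sup>2) has_sum (S True + S False + S True + S False)) UNIV" .
    moreover have "S True + S False + S True + S False = 1"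
      using comb_norm unfolding S_def if_True if_False by linarith
    ultimately show ?thesis by simp
  qed
  have ss_v: "square_summable (v x)" for x
  proof -
    have "((\<lambda>j. (norm x)\<^sup>2 * (w j)\<^sup>2) has_sum ((norm x)\<^sup>2 * 1)) UNIV"
      by (rule has_sum_cmult_right[OF w_sum])
    then show ?thesis
      unfolding square_summable_def v_def
      by (simp add: W_norm power_mult_distrib mult.commute has_sum_imp_summable)
  qed
  have V_add: "V (x + y) = V x + V y" and V_scale: "V (a *\<^sub>C x) = a *\<^sub>C V x" for x y a
  proof -
    show "V (x + y) = V x + V y"
      unfolding V_def family_add[OF ss_v ss_v, symmetric]
      by (rule arg_cong[of _ _ family]) (auto simp: v_def W_add scaleR_add_right)
    show "V (a *\<^sub>C x) = a *\<^sub>C V x"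
      unfolding V_def family_scaleC[OF ss_v, symmetric]
      by (rule arg_cong[of _ _ family])
        (auto simp: v_def W_scale scaleC_of_real[symmetric] scaleC_scaleC mult.commute)
  qed
  have V_cinner: "cinner (V x) (V y) = cinner x y" for x y
  proof -
    have "((\<lambda>j. cinner x y * complex_of_real ((w j)\<^sup>2)) has_sum (cinner x y * complex_of_real 1)) UNIV"
      by (intro has_sum_cmult_right has_sum_of_real w_sum)
    moreover have "cinner (v x j) (v y j) = cinner x y * complex_of_real ((w j)\<^sup>2)" for j
      by (simp add: v_def cinner_scaleR_left cinner_scaleR_right W_cinner power2_eq_square)
    ultimately show ?thesis
      using family_cinner[OF ss_v[of x] ss_v[of y]] has_sum_unique unfolding V_def by simp
  qed
  \<comment> \<open>Every pair of indices joined by \<open>N c\<close> contributes the operator \<open>U c\<close> times the product \<open>e j\<close> of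
    its weights. Only \<open>y = 0\<close> counts for the exchange, where no power of the other unitary enters.\<close>
  have N_V: "cinner (N c (V x)) (V y) = (sqrt golden_ratio / 2) * cinner (U c x) y" for c x y
  proof -
    define e where "e j = w (p c j) * w j" for j
    have e_sum: "(e has_sum (sqrt golden_ratio / 2)) UNIV"
    proof -
      define S where "S r s = (if r = c then (1/2) * (even_weight * odd_weight)
        else if s then (1/2) * (even_weight\<^sup>2 * (2 * decay / (1 - decay\<^sup>2))) else 0)" for r s
      have "((\<lambda>y. e (r, y, s)) has_sum S r s) UNIV" for r s
      proof -
        consider "r = c" | "r \<noteq> c" "s" | "r \<noteq> c" "\<not> s" by blast
        then show ?thesis
        proof cases
          case 1
          have "((\<lambda>y :: int. e (r, y, s)) has_sum S r s) {0}"
            using 1 by (simp add: e_def p w_def S_def has_sum_finiteI)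
          then show ?thesis
            by (subst has_sum_cong_neutral[where S = UNIV and T = "{0}"])
              (use 1 in \<open>auto simp: e_def p w_def\<close>)
        next
          case 2
          have "((\<lambda>y :: int. (1/2) * (even_weight\<^sup>2 * (decay ^ nat \<bar>y + 1\<bar> * decay ^ nat \<bar>y\<bar>)))
              has_sum S r s) UNIV"
            unfolding S_def using 2
            by (simp only: if_True if_False) (intro has_sum_cmult_right has_sum_tooth_edges \<mu>)
          then show ?thesis using 2 by (simp add: e_def p w_def power2_eq_square mult_ac)
        next
          case 3
          then have "e (r, y, s) = 0" for y by (simp add: e_def p w_def)
          then show ?thesis using 3 by (simp add: S_def)
        qed
      qed
      from has_sum_two_combs[OF this]
      have "(e has_sum (S True True + S True False + S False True + S False False)) UNIV" .
      moreover have "S True True + S True False + S False True + S False False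
          = even_weight * odd_weight + even_weight\<^sup>2 * (decay / (1 - decay\<^sup>2))"
        by (cases c) (simp_all add: S_def)
      ultimately show ?thesis by (simp only: comb_edges)
    qed
    have summand: "cinner (M c j (v x (p c j))) (v y j) = cinner (U c x) y * complex_of_real (e j)" for j
    proof -
      obtain r t s where j: "j = (r, t, s)" by (cases j)
      have U_scaleR: "U c (k *\<^sub>R z) = k *\<^sub>R U c z" for k z
        using U[of c] unfolding unitary_pair_def clinear_on_def by (metis UNIV_I scaleC_of_real)
      have "cinner (M c j (W (p c j) x)) (W j y) = cinner (U c x) y" if "e j \<noteq> 0"
      proof (cases "r = c")
        case True
        then have "t = 0" using that by (auto simp: e_def j p w_def split: if_splits)
        then show ?thesis using True by (simp add: j p M_def W_def unitary_power_def)
      next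
        case False
        then have "s" using that by (auto simp: e_def j p w_def split: if_splits)
        have c: "c = (\<not> r)" using False by blast
        have "W (p c j) x = W j (U c x)"
          using \<open>s\<close> False unitary_power_step[OF U[of c], of t x] by (simp add: j p W_def c)
        then show ?thesis using False W_cinner by (simp add: j M_def)
      qed
      then show ?thesis
        by (cases "e j = 0")
          (auto simp: v_def e_def M_def U_scaleR cinner_scaleR_left cinner_scaleR_right split: prod.splits if_splits)
    qed
    have "N c (V x) = family (\<lambda>j. M c j (v x (p c j)))"
      unfolding N_def V_def by (rule monomial_op_family[OF ss_v])
    then have "((\<lambda>j. cinner (U c x) y * complex_of_real (e j)) has_sum cinner (N c (V x)) (V y)) UNIV"
      using family_cinner[OF square_summable_monomial[where U = "M c", OF bij_p[of c] M ss_v[of x]] ss_v[of y]]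
      by (simp add: V_def summand)
    moreover have "((\<lambda>j. cinner (U c x) y * complex_of_real (e j))
        has_sum (cinner (U c x) y * complex_of_real (sqrt golden_ratio / 2))) UNIV"
      by (intro has_sum_cmult_right has_sum_of_real e_sum)
    ultimately show ?thesis using has_sum_unique by fastforce
  qed
  have N_commute: "N c (N c' x) = N c' (N c x)" if "x \<in> K" for c c' x
  proof -
    obtain v where v: "square_summable v" "x = family v" using \<open>x \<in> K\<close> by (rule family_cases)
    have "N c (N c' x) = family (\<lambda>j. M c j (M c' (p c j) (v (p c' (p c j)))))" for c c'
      unfolding N_def v(2) using square_summable_monomial[where U = "M c'", OF bij_p[of c'] M v(1)]
      by (simp add: monomial_op_family v(1))
    moreover have "M c j (M c' (p c j) (v (p c' (p c j)))) = M c' j (M c (p c' j) (v (p c (p c' j))))" for j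
      by (cases j; cases "c = c'") (auto simp: M_def p)
    ultimately show ?thesis by presburger
  qed
  have "clinear_on UNIV V" by (simp add: clinear_on_def V_add V_scale)
  moreover have "range V \<subseteq> K" by (auto simp: V_def intro: family_in ss_v)
  moreover have "unitary_on K (N c)" for c
    unfolding N_def by (rule monomial_op_unitary[OF bij_p M])
  ultimately show ?thesis
    using V_cinner N_V N_commute
    by (intro exI[of _ V] exI[of _ N] conjI allI) (auto simp: commute_on_def)
qed

section \<open>Dilation of a pair of contractions\<close>

lemma complex_projection_exists:
  fixes H :: "'h::complex_hilbert_space set"
  assumes H: "hilbert_subspace H"
  obtains P where "clinear_on UNIV P" "\<And>x. P x \<in> H" "\<And>x. x \<in> H \<Longrightarrow> P x = x"
    "\<And>x. norm (P x) \<le> norm x"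
proof -
  have cs: "complex_vector.subspace H" and cl: "closed H" using H by (auto simp: hilbert_subspace_def)
  have "\<exists>y. y \<in> H \<and> (\<forall>z\<in>H. inner (x - y) z = 0)" for x
    using orthogonal_projection_exists[OF complex_subspace_imp_subspace[OF cs] cl] by metis
  then obtain P where P: "\<And>x. P x \<in> H" "\<And>x z. z \<in> H \<Longrightarrow> inner (x - P x) z = 0" by metis
  have P_cinner: "cinner (x - P x) z = 0" if "z \<in> H" for x z
    using P(2)[OF that] P(2)[OF complex_vector.subspace_scale[OF cs that]]
    by (simp add: cinner_eq_inner complex_eq_iff)
  have P_eq: "P x = y" if "y \<in> H" "\<And>z. z \<in> H \<Longrightarrow> cinner (x - y) z = 0" for x y
  proof -
    have d: "P x - y \<in> H" using P(1) that(1) cs by (intro complex_vector.subspace_diff)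
    have "cinner (P x - y) (P x - y) = cinner (x - y) (P x - y) - cinner (x - P x) (P x - y)"
      by (simp add: cinner_diff_left)
    then show ?thesis using that(2)[OF d] P_cinner[OF d] by (simp add: cinner_self)
  qed
  show ?thesis
  proof (rule that[of P])
    show "P x \<in> H" for x by (rule P)
    show "P x = x" if "x \<in> H" for x using that by (intro P_eq) auto
    show "norm (P x) \<le> norm x" for x
    proof -
      have "(norm (P x))\<^sup>2 = inner x (P x)"
        using P(2)[OF P(1), of x x] by (simp add: power2_norm_eq_inner inner_diff_left)
      also have "\<dots> \<le> norm x * norm (P x)" by (rule norm_cauchy_schwarz)
      finally show ?thesis by (cases "P x = 0") (auto simp: power2_eq_square)
    qed
    show "clinear_on UNIV P"
      unfolding clinear_on_def
    proof (intro conjI ballI allI)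
      fix x y
      show "P (x + y) = P x + P y"
      proof (rule P_eq)
        show "P x + P y \<in> H" using cs P(1) by (intro complex_vector.subspace_add)
        show "cinner (x + y - (P x + P y)) z = 0" if "z \<in> H" for z
          using P_cinner[OF that, of x] P_cinner[OF that, of y]
          by (simp add: cinner_diff_left cinner_add_left)
      qed
    next
      fix a x
      show "P (a *\<^sub>C x) = a *\<^sub>C P x"
      proof (rule P_eq)
        show "a *\<^sub>C P x \<in> H" using cs P(1) by (intro complex_vector.subspace_scale)
        show "cinner (a *\<^sub>C x - a *\<^sub>C P x) z = 0" if "z \<in> H" for z
          using P_cinner[OF that, of x]
          by (simp add: scaleC_diff_right[symmetric] cinner_scaleC_left)
      qed
    qed
  qed
qed

text \<open>The entries at \<open>0\<close> and \<open>1\<close> store the pair, and the position of the only other nonzero entry stores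
  the countable index.\<close>

lemma index_injection:
  obtains \<iota> :: "('j::countable) \<times> ('h::zero \<times> 'h) \<Rightarrow> nat \<Rightarrow> 'h" where "inj_on \<iota> {p. snd p \<noteq> 0}"
proof -
  define \<iota> :: "'j \<times> ('h \<times> 'h) \<Rightarrow> nat \<Rightarrow> 'h" where "\<iota> = (\<lambda>(j, x, y) n. if n = 0 then x else if n = 1 then y
      else if n = to_nat j + 2 then (if x = 0 then y else x) else 0)"
  have "inj_on \<iota> {p. snd p \<noteq> 0}"
  proof (rule inj_onI)
    fix p q assume nz: "p \<in> {p. snd p \<noteq> 0}" "q \<in> {p. snd p \<noteq> 0}" and eq: "\<iota> p = \<iota> q"
    obtain j x y where p: "p = (j, x, y)" by (cases p)
    obtain j' x' y' where q: "q = (j', x', y')" by (cases q)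
    have "x = x'" "y = y'"
      using fun_cong[OF eq, of 0] fun_cong[OF eq, of 1] by (simp_all add: p q \<iota>_def)
    moreover have "to_nat j = to_nat j'"
      using fun_cong[OF eq, of "to_nat j + 2"] nz
      by (auto simp: p q \<iota>_def zero_prod_def split: if_splits)
    ultimately show "p = q" by (simp add: p q)
  qed
  then show ?thesis by (rule that)
qed

text \<open>Composing with the projection onto \<open>H\<close> extends the contractions to the whole type, where
  the unitary dilation applies; the pair is indexed by the truth values.\<close>

theorem contraction_pair_dilation:
  fixes H :: "'h::complex_hilbert_space set" and T :: "bool \<Rightarrow> 'h \<Rightarrow> 'h"
  assumes H: "hilbert_subspace H" and T: "\<And>c. contraction_op H (T c)"
  shows "\<exists>(K :: (nat \<Rightarrow> 'h) ell2 set) V N.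
    hilbert_subspace K \<and> isometric_embedding H K V \<and>
    (\<forall>c. unitary_on K (N c)) \<and> (\<forall>c c'. commute_on K (N c) (N c')) \<and>
    (\<forall>c. compression_of H V (T c) (\<lambda>x. (2 / sqrt golden_ratio) *\<^sub>R N c x))"
proof -
  have cs: "complex_vector.subspace H" using H by (simp add: hilbert_subspace_def)
  obtain P where P: "clinear_on UNIV P" "\<And>x. P x \<in> H" "\<And>x. x \<in> H \<Longrightarrow> P x = x"
    "\<And>x. norm (P x) \<le> norm x"
    using complex_projection_exists[OF H] by blast
  have TH: "T c x \<in> H" if "x \<in> H" for c x
    using T[of c] that unfolding contraction_op_def bounded_op_def by blast
  have "\<exists>U U' :: 'h \<times> 'h \<Rightarrow> 'h \<times> 'h. unitary_pair U U' \<and> (\<forall>x. fst (U (x, 0)) = T c (P x))" for c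
  proof -
    have lin: "clinear_on UNIV (\<lambda>x. T c (P x))"
      using T[of c] P(1,2) unfolding contraction_op_def bounded_op_def clinear_on_def by simp
    have "norm (T c (P x)) \<le> norm x" for x
    proof -
      have "norm (T c (P x)) \<le> op_norm H (T c) * norm (P x)"
        using T[of c] P(2) by (intro bounded_op_norm_le) (auto simp: contraction_op_def)
      also have "\<dots> \<le> 1 * norm (P x)"
        using T[of c] by (intro mult_right_mono) (auto simp: contraction_op_def)
      finally show ?thesis using P(4)[of x] by simp
    qed
    from halmos_unitary_dilation[OF lin this] obtain U U' :: "'h \<times> 'h \<Rightarrow> 'h \<times> 'h"
      where "unitary_pair U U'" "\<And>x. fst (U (x, 0)) = T c (P x)" by blast
    then show ?thesis by blast
  qed
  then have "\<forall>c. \<exists>U U' :: 'h \<times> 'h \<Rightarrow> 'h \<times> 'h. unitary_pair U U' \<and> (\<forall>x. fst (U (x, 0)) = T c (P x))"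
    by blast
  then obtain U U' :: "bool \<Rightarrow> 'h \<times> 'h \<Rightarrow> 'h \<times> 'h" where
    "\<forall>c. unitary_pair (U c) (U' c) \<and> (\<forall>x. fst (U c (x, 0)) = T c (P x))"
    unfolding choice_iff by blast
  then have U: "unitary_pair (U c) (U' c)" and UT: "fst (U c (x, 0)) = T c (P x)" for c x
    by blast+
  obtain \<iota> :: "(bool \<times> int \<times> bool) \<times> ('h \<times> 'h) \<Rightarrow> nat \<Rightarrow> 'h" where \<iota>: "inj_on \<iota> {p. snd p \<noteq> 0}"
    by (rule index_injection)
  obtain K :: "(nat \<Rightarrow> 'h) ell2 set" and family :: "(bool \<times> int \<times> bool \<Rightarrow> 'h \<times> 'h) \<Rightarrow> _"
    where K: "hilbert_sum K family"
    by (rule hilbert_sum_exists[OF \<iota>])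
  obtain W :: "'h \<times> 'h \<Rightarrow> (nat \<Rightarrow> 'h) ell2" and N where
    WN: "clinear_on UNIV W \<and> range W \<subseteq> K \<and> (\<forall>x y. cinner (W x) (W y) = cinner x y) \<and>
      (\<forall>c. unitary_on K (N c)) \<and> (\<forall>c c'. commute_on K (N c) (N c')) \<and>
      (\<forall>c x y. cinner (N c (W x)) (W y) = (sqrt golden_ratio / 2) * cinner (U c x) y)"
    using comb_dilation[of K family U U', OF K U] by (elim exE) (rule that)
  then have W: "clinear_on UNIV W" "range W \<subseteq> K" "cinner (W x) (W y) = cinner x y"
    and NW: "cinner (N c (W x)) (W y) = (sqrt golden_ratio / 2) * cinner (U c x) y" for c x y
    by blast+
  define V where "V x = W (x, 0)" for x
  have V_lin: "clinear_on H V"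
    unfolding clinear_on_def V_def
  proof (intro conjI ballI allI)
    have add: "W (p + q) = W p + W q" and scale: "W (a *\<^sub>C p) = a *\<^sub>C W p" for p q a
      using W(1) unfolding clinear_on_def by blast+
    show "W (x + y, 0) = W (x, 0) + W (y, 0)" "W (a *\<^sub>C x, 0) = a *\<^sub>C W (x, 0)" for x y a
      using add[of "(x, 0)" "(y, 0)"] scale[of a "(x, 0)"] by (simp_all add: scaleC_prod_def)
  qed
  have V_cinner: "cinner (V x) (V y) = cinner x y" for x y
    by (simp add: V_def W(3) cinner_prod_def)
  have V_norm: "norm (V x) = norm x" for x
  proof -
    have "(norm (V x))\<^sup>2 = (norm x)\<^sup>2"
      using V_cinner[of x x] by (simp add: cinner_self flip: of_real_power)
    then show ?thesis by simp
  qed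
  have "compression_of H V (T c) (\<lambda>x. (2 / sqrt golden_ratio) *\<^sub>R N c x)" for c
  proof (rule compression_ofI[OF cs TH V_lin V_cinner])
    fix x y assume x: "x \<in> H" and "y \<in> H"
    have "cinner (U c (x, 0)) (y, 0) = cinner (T c x) y"
      by (simp add: cinner_prod_def UT P(3)[OF x])
    moreover have "sqrt golden_ratio \<noteq> 0" using golden_ratio_pos by simp
    ultimately show "cinner ((2 / sqrt golden_ratio) *\<^sub>R N c (V x)) (V y) = cinner (T c x) y"
      by (simp add: cinner_scaleR_left V_def NW)
  qed
  moreover have "isometric_embedding H K V"
    using V_lin V_norm W(2) by (auto simp: isometric_embedding_def V_def)
  moreover have "hilbert_subspace K" using K by (simp add: hilbert_sum_def)
  ultimately show ?thesis using WN by (intro exI[of _ K] exI[of _ V] exI[of _ N]) simp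
qed

lemma has_commuting_normal_dilation_golden:
  fixes H :: "'h::complex_hilbert_space set"
  assumes H: "hilbert_subspace H" and A: "\<And>i. i < 2 \<Longrightarrow> contraction_op H (A i)"
  shows "has_commuting_normal_dilation H 2 A (2 / sqrt golden_ratio)"
proof -
  define c where "c = 2 / sqrt golden_ratio"
  have c: "0 \<le> c" using golden_ratio_pos by (simp add: c_def)
  have "contraction_op H (A (if b then 0 else 1))" for b :: bool using A by simp
  from contraction_pair_dilation[of H "\<lambda>b. A (if b then 0 else 1)", OF H this]
  obtain K :: "(nat \<Rightarrow> 'h) ell2 set" and V N where K: "hilbert_subspace K" "isometric_embedding H K V"
    and N: "\<And>b. unitary_on K (N b)" "\<And>b b'. commute_on K (N b) (N b')"
    "\<And>b. compression_of H V (A (if b then 0 else 1)) (\<lambda>x. c *\<^sub>R N b x)"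
    unfolding c_def by blast
  have K_sub: "complex_vector.subspace K" using K(1) by (simp add: hilbert_subspace_def)
  define B where "B i = (\<lambda>x. c *\<^sub>R N (i = 0) x)" for i :: nat
  have N_mem: "N b x \<in> K" and N_scale: "N b (c *\<^sub>R x) = c *\<^sub>R N b x" if "x \<in> K" for b x
    using N(1)[of b] that unfolding unitary_on_def clinear_on_def
    by (auto simp: scaleC_of_real[symmetric])
  have "commute_on K (B i) (B j)" for i j
    using N(2) N_mem N_scale by (simp add: commute_on_def B_def)
  moreover have "compression_of H V (A i) (B i)" if "i < 2" for i
  proof -
    have "i = 0 \<or> i = 1" using that by linarith
    then show ?thesis using N(3)[of True] N(3)[of False] by (auto simp: B_def)
  qed
  ultimately show ?thesis
    unfolding has_commuting_normal_dilation_def c_def[symmetric]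
    using K unitary_on_imp_scaled_normal[OF K_sub N(1) c]
    by (intro exI[of _ K] exI[of _ V] exI[of _ B]) (auto simp: B_def)
qed

text \<open>The infimum is over a set of reals, so that a lower bound has to be exhibited: every admissible
  constant bounds an operator norm already for the zero operators on the zero space.\<close>

lemma universal_dilation_constant_le:
  assumes "\<And>(H :: 'h::complex_hilbert_space set) A. hilbert_subspace H \<Longrightarrow>
      (\<And>i. i < d \<Longrightarrow> contraction_op H (A i)) \<Longrightarrow> has_commuting_normal_dilation H d A \<alpha>"
    and "d > 0"
  shows "universal_dilation_constant TYPE('h) d \<le> \<alpha>"
  unfolding universal_dilation_constant_def
proof (rule cInf_lower)
  show "\<alpha> \<in> {\<alpha>. \<forall>(H :: 'h set) A. hilbert_subspace H \<and> (\<forall>i<d. contraction_op H (A i)) \<longrightarrow>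
      has_commuting_normal_dilation H d A \<alpha>}"
    using assms(1) by blast
  show "bdd_below {\<alpha>. \<forall>(H :: 'h set) A. hilbert_subspace H \<and> (\<forall>i<d. contraction_op H (A i)) \<longrightarrow>
      has_commuting_normal_dilation H d A \<alpha>}"
  proof (rule bdd_belowI[of _ 0])
    fix \<beta> assume \<beta>: "\<beta> \<in> {\<alpha>. \<forall>(H :: 'h set) A. hilbert_subspace H \<and> (\<forall>i<d. contraction_op H (A i)) \<longrightarrow>
      has_commuting_normal_dilation H d A \<alpha>}"
    have "hilbert_subspace {0 :: 'h}"
      by (simp add: hilbert_subspace_def)
    moreover have "contraction_op {0 :: 'h} (\<lambda>_. 0)"
      by (auto simp: contraction_op_def bounded_op_def clinear_on_def op_norm_def)
    ultimately have "has_commuting_normal_dilation {0 :: 'h} d (\<lambda>_ _. 0) \<beta>"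
      using \<beta>[unfolded mem_Collect_eq, rule_format, of "{0}" "\<lambda>_ _. 0"] by simp
    then obtain K :: "(nat \<Rightarrow> 'h) ell2 set" and B where "hilbert_subspace K" "normal_op K (B 0)"
      "op_norm K (B (0 :: nat)) \<le> \<beta>"
      unfolding has_commuting_normal_dilation_def using \<open>d > 0\<close> by blast
    then have "0 \<le> op_norm K (B 0)" and "op_norm K (B 0) \<le> \<beta>"
      by (auto intro: op_norm_nonneg complex_vector.subspace_0 simp: normal_op_def hilbert_subspace_def)
    then show "0 \<le> \<beta>" by linarith
  qed
qed

theorem theorem1:
  shows "(\<forall>(H :: 'h::complex_hilbert_space set) T1 T2.
            hilbert_subspace H \<and> contraction_op H T1 \<and> contraction_op H T2 \<longrightarrow>
            (\<exists>(K :: (nat \<Rightarrow> 'h) ell2 set) V N1 N2.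
               hilbert_subspace K \<and> isometric_embedding H K V \<and>
               normal_op K N1 \<and> normal_op K N2 \<and>
               contraction_op K N1 \<and> contraction_op K N2 \<and> commute_on K N1 N2 \<and>
               compression_of H V T1 (\<lambda>x. (2 / sqrt golden_ratio) *\<^sub>R N1 x) \<and>
               compression_of H V T2 (\<lambda>x. (2 / sqrt golden_ratio) *\<^sub>R N2 x)))
         \<and> universal_dilation_constant TYPE('h) 2 \<le> 2 / sqrt golden_ratio"
proof (intro conjI allI impI)
  fix H :: "'h set" and T1 T2
  assume asm: "hilbert_subspace H \<and> contraction_op H T1 \<and> contraction_op H T2"
  then have "contraction_op H (if b then T1 else T2)" for b by simp
  from contraction_pair_dilation[of H "\<lambda>b. if b then T1 else T2", OF conjunct1[OF asm] this]
  obtain K :: "(nat \<Rightarrow> 'h) ell2 set" and V N where K: "hilbert_subspace K" "isometric_embedding H K V"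
    and N: "\<And>b. unitary_on K (N b)" "\<And>b b'. commute_on K (N b) (N b')"
    "\<And>b. compression_of H V (if b then T1 else T2) (\<lambda>x. (2 / sqrt golden_ratio) *\<^sub>R N b x)"
    by blast
  have "normal_op K (N b)" "contraction_op K (N b)" for b
    using unitary_on_imp_scaled_normal[OF _ N(1), of 1 b] K(1)
    by (simp_all add: contraction_op_def normal_op_def hilbert_subspace_def)
  then show "\<exists>(K :: (nat \<Rightarrow> 'h) ell2 set) V N1 N2.
               hilbert_subspace K \<and> isometric_embedding H K V \<and>
               normal_op K N1 \<and> normal_op K N2 \<and>
               contraction_op K N1 \<and> contraction_op K N2 \<and> commute_on K N1 N2 \<and>
               compression_of H V T1 (\<lambda>x. (2 / sqrt golden_ratio) *\<^sub>R N1 x) \<and>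
               compression_of H V T2 (\<lambda>x. (2 / sqrt golden_ratio) *\<^sub>R N2 x)"
    using K N(2) N(3)[of True] N(3)[of False]
    by (intro exI[of _ K] exI[of _ V] exI[of _ "N True"] exI[of _ "N False"]) simp
next
  show "universal_dilation_constant TYPE('h) 2 \<le> 2 / sqrt golden_ratio"
    by (rule universal_dilation_constant_le) (auto intro: has_commuting_normal_dilation_golden)
qed

end
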